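(* $\mathsf{LNS}$ does not imply $\mathsf{SADS}$ over $\mathsf{RCA}_0$, and $\mathsf{LNS}$ does not imply $\mathsf{CNS}$ over $\mathsf{RCA}_0$; that is, $\mathsf{RCA}_0 + \mathsf{LNS} \nvdash \mathsf{SADS}$ and $\mathsf{RCA}_0 + \mathsf{LNS} \nvdash \mathsf{CNS}$.
   Context: $\mathsf{RCA}_0$ is the usual base system of reverse mathematics (second-order arithmetic with $\Delta^0_1$ comprehension and $\Sigma^0_1$ induction). $\mathsf{LNS}$ (limit non-decreasing subsequence): for every $f : \mathbb{N}\times\mathbb{N}\to\mathbb{N}$ such that $f(x,s+1)\leq f(x,s)$ for every $x,s\in\mathbb{N}$, there is an infinite set $X\subseteq\mathbb{N}$ such that $\lim_s f(x,s)\leq\lim_s f(y,s)$ for all $x<y$ in $X$. $\mathsf{CNS}$ (computably bounded non-decreasing subsequence): "Every computably bounded $\Delta^0_2$ function admits an infinite non-decreasing subsequence." Formally: for every $f : \mathbb{N}\times\mathbb{N} \to \mathbb{N}$ such that $\tilde f(x) = \lim_s f(x,s)$ exists for every $x$, and every $b : \mathbb{N}\to\mathbb{N}$ such that $\tilde f(x) \leq b(x)$ for all $x$, there is an infinite set $X \subseteq \mathbb{N}$ such that $\tilde f(x) \leq \tilde f(y)$ for all $x<y$ in $X$. $\mathsf{SADS}$ (stable ascending descending sequence principle): every infinite linear order $(L,<_L)$ with $L\subseteq\mathbb{N}$ that is stable, i.e. in which every element has either finitely many $<_L$-predecessors or finitely many $<_L$-successors, has an infinite $<_L$-ascending sequence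 or an infinite $<_L$-descending sequence. *)

theory Defs
  imports Main
begin

section \<open>The language of second-order arithmetic\<close>

text \<open>Two-sorted first-order logic with number variables and set variables, the two sorts having
  separate name spaces. As usual there is no primitive equality between sets.\<close>

datatype tm = Var string | Zero | One | Add tm tm | Mul tm tm

datatype fm =
    Eq tm tm
  | Less tm tm
  | Mem tm string
  | Neg fm
  | Imp fm fm
  | AllN string fm
  | AllS string fm

abbreviation Disj :: "fm \<Rightarrow> fm \<Rightarrow> fm" where
  "Disj \<phi> \<psi> \<equiv> Imp (Neg \<phi>) \<psi>"

abbreviation Conj :: "fm \<Rightarrow> fm \<Rightarrow> fm" where
  "Conj \<phi> \<psi> \<equiv> Neg (Imp \<phi> (Neg \<psi>))"

abbreviation Iff :: "fm \<Rightarrow> fm \<Rightarrow> fm" where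
  "Iff \<phi> \<psi> \<equiv> Conj (Imp \<phi> \<psi>) (Imp \<psi> \<phi>)"

abbreviation ExN :: "string \<Rightarrow> fm \<Rightarrow> fm" where
  "ExN x \<phi> \<equiv> Neg (AllN x (Neg \<phi>))"

abbreviation ExS :: "string \<Rightarrow> fm \<Rightarrow> fm" where
  "ExS X \<phi> \<equiv> Neg (AllS X (Neg \<phi>))"

abbreviation Leq :: "tm \<Rightarrow> tm \<Rightarrow> fm" where
  "Leq s t \<equiv> Disj (Less s t) (Eq s t)"

abbreviation AllNs :: "string list \<Rightarrow> fm \<Rightarrow> fm" where
  "AllNs xs \<phi> \<equiv> foldr AllN xs \<phi>"

abbreviation ExNs :: "string list \<Rightarrow> fm \<Rightarrow> fm" where
  "ExNs xs \<phi> \<equiv> foldr ExN xs \<phi>"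

fun Conjs :: "fm list \<Rightarrow> fm" where
  "Conjs [] = Eq Zero Zero"
| "Conjs [\<phi>] = \<phi>"
| "Conjs (\<phi> # \<psi> # \<phi>s) = Conj \<phi> (Conjs (\<psi> # \<phi>s))"

section \<open>Free variables and substitution\<close>

primrec vars_tm :: "tm \<Rightarrow> string set" where
  "vars_tm (Var x) = {x}"
| "vars_tm Zero = {}"
| "vars_tm One = {}"
| "vars_tm (Add s t) = vars_tm s \<union> vars_tm t"
| "vars_tm (Mul s t) = vars_tm s \<union> vars_tm t"

primrec freeN :: "fm \<Rightarrow> string set" where
  "freeN (Eq s t) = vars_tm s \<union> vars_tm t"
| "freeN (Less s t) = vars_tm s \<union> vars_tm t"
| "freeN (Mem t X) = vars_tm t"
| "freeN (Neg \<phi>) = freeN \<phi>"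
| "freeN (Imp \<phi> \<psi>) = freeN \<phi> \<union> freeN \<psi>"
| "freeN (AllN x \<phi>) = freeN \<phi> - {x}"
| "freeN (AllS X \<phi>) = freeN \<phi>"

primrec freeS :: "fm \<Rightarrow> string set" where
  "freeS (Eq s t) = {}"
| "freeS (Less s t) = {}"
| "freeS (Mem t X) = {X}"
| "freeS (Neg \<phi>) = freeS \<phi>"
| "freeS (Imp \<phi> \<psi>) = freeS \<phi> \<union> freeS \<psi>"
| "freeS (AllN x \<phi>) = freeS \<phi>"
| "freeS (AllS X \<phi>) = freeS \<phi> - {X}"

primrec subst_tm :: "string \<Rightarrow> tm \<Rightarrow> tm \<Rightarrow> tm" where
  "subst_tm x t (Var y) = (if y = x then t else Var y)"
| "subst_tm x t Zero = Zero"
| "subst_tm x t One = One"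
| "subst_tm x t (Add r s) = Add (subst_tm x t r) (subst_tm x t s)"
| "subst_tm x t (Mul r s) = Mul (subst_tm x t r) (subst_tm x t s)"

text \<open>Substitution does not rename bound variables; it is only used under the side conditions
  \<open>free_forN\<close> and \<open>free_forS\<close>, which exclude capture.\<close>

primrec substN :: "string \<Rightarrow> tm \<Rightarrow> fm \<Rightarrow> fm" where
  "substN x t (Eq r s) = Eq (subst_tm x t r) (subst_tm x t s)"
| "substN x t (Less r s) = Less (subst_tm x t r) (subst_tm x t s)"
| "substN x t (Mem s X) = Mem (subst_tm x t s) X"
| "substN x t (Neg \<phi>) = Neg (substN x t \<phi>)"
| "substN x t (Imp \<phi> \<psi>) = Imp (substN x t \<phi>) (substN x t \<psi>)"
| "substN x t (AllN y \<phi>) = AllN y (if y = x then \<phi> else substN x t \<phi>)"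
| "substN x t (AllS Y \<phi>) = AllS Y (substN x t \<phi>)"

primrec substS :: "string \<Rightarrow> string \<Rightarrow> fm \<Rightarrow> fm" where
  "substS X Y (Eq r s) = Eq r s"
| "substS X Y (Less r s) = Less r s"
| "substS X Y (Mem s Z) = Mem s (if Z = X then Y else Z)"
| "substS X Y (Neg \<phi>) = Neg (substS X Y \<phi>)"
| "substS X Y (Imp \<phi> \<psi>) = Imp (substS X Y \<phi>) (substS X Y \<psi>)"
| "substS X Y (AllN y \<phi>) = AllN y (substS X Y \<phi>)"
| "substS X Y (AllS Z \<phi>) = AllS Z (if Z = X then \<phi> else substS X Y \<phi>)"

primrec free_forN :: "tm \<Rightarrow> string \<Rightarrow> fm \<Rightarrow> bool" where
  "free_forN t x (Eq r s) = True"
| "free_forN t x (Less r s) = True"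
| "free_forN t x (Mem s X) = True"
| "free_forN t x (Neg \<phi>) = free_forN t x \<phi>"
| "free_forN t x (Imp \<phi> \<psi>) = (free_forN t x \<phi> \<and> free_forN t x \<psi>)"
| "free_forN t x (AllN y \<phi>) =
    (x \<notin> freeN (AllN y \<phi>) \<or> y \<notin> vars_tm t \<and> free_forN t x \<phi>)"
| "free_forN t x (AllS Y \<phi>) = free_forN t x \<phi>"

primrec free_forS :: "string \<Rightarrow> string \<Rightarrow> fm \<Rightarrow> bool" where
  "free_forS Y X (Eq r s) = True"
| "free_forS Y X (Less r s) = True"
| "free_forS Y X (Mem s Z) = True"
| "free_forS Y X (Neg \<phi>) = free_forS Y X \<phi>"
| "free_forS Y X (Imp \<phi> \<psi>) = (free_forS Y X \<phi> \<and> free_forS Y X \<psi>)"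
| "free_forS Y X (AllN y \<phi>) = free_forS Y X \<phi>"
| "free_forS Y X (AllS Z \<phi>) =
    (X \<notin> freeS (AllS Z \<phi>) \<or> Z \<noteq> Y \<and> free_forS Y X \<phi>)"

section \<open>Provability\<close>

text \<open>A Hilbert calculus in Mendelson's style for classical two-sorted logic with equality between
  numbers. Generalization is unrestricted, so axioms with free variables stand for their universal
  closures.\<close>

inductive provable :: "fm set \<Rightarrow> fm \<Rightarrow> bool" (infix \<open>\<turnstile>\<close> 50) for \<Gamma> :: "fm set" where
  Axm: "\<phi> \<in> \<Gamma> \<Longrightarrow> \<Gamma> \<turnstile> \<phi>"
| MP: "\<Gamma> \<turnstile> Imp \<phi> \<psi> \<Longrightarrow> \<Gamma> \<turnstile> \<phi> \<Longrightarrow> \<Gamma> \<turnstile> \<psi>"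
| GenN: "\<Gamma> \<turnstile> \<phi> \<Longrightarrow> \<Gamma> \<turnstile> AllN x \<phi>"
| GenS: "\<Gamma> \<turnstile> \<phi> \<Longrightarrow> \<Gamma> \<turnstile> AllS X \<phi>"
| P1: "\<Gamma> \<turnstile> Imp \<phi> (Imp \<psi> \<phi>)"
| P2: "\<Gamma> \<turnstile> Imp (Imp \<phi> (Imp \<psi> \<chi>)) (Imp (Imp \<phi> \<psi>) (Imp \<phi> \<chi>))"
| P3: "\<Gamma> \<turnstile> Imp (Imp (Neg \<phi>) (Neg \<psi>)) (Imp (Imp (Neg \<phi>) \<psi>) \<phi>)"
| InstN: "free_forN t x \<phi> \<Longrightarrow> \<Gamma> \<turnstile> Imp (AllN x \<phi>) (substN x t \<phi>)"
| InstS: "free_forS Y X \<phi> \<Longrightarrow> \<Gamma> \<turnstile> Imp (AllS X \<phi>) (substS X Y \<phi>)"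
| DistN: "x \<notin> freeN \<phi> \<Longrightarrow> \<Gamma> \<turnstile> Imp (AllN x (Imp \<phi> \<psi>)) (Imp \<phi> (AllN x \<psi>))"
| DistS: "X \<notin> freeS \<phi> \<Longrightarrow> \<Gamma> \<turnstile> Imp (AllS X (Imp \<phi> \<psi>)) (Imp \<phi> (AllS X \<psi>))"
| Refl: "\<Gamma> \<turnstile> Eq t t"
| Leibniz: "free_forN s x \<phi> \<Longrightarrow> free_forN t x \<phi> \<Longrightarrow>
    \<Gamma> \<turnstile> Imp (Eq s t) (Imp (substN x s \<phi>) (substN x t \<phi>))"

section \<open>The system \<open>RCA\<^sub>0\<close>\<close>

inductive bounded_fm :: "fm \<Rightarrow> bool" where
  "bounded_fm (Eq s t)"
| "bounded_fm (Less s t)"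
| "bounded_fm (Mem t X)"
| "bounded_fm \<phi> \<Longrightarrow> bounded_fm (Neg \<phi>)"
| "bounded_fm \<phi> \<Longrightarrow> bounded_fm \<psi> \<Longrightarrow> bounded_fm (Imp \<phi> \<psi>)"
| "bounded_fm \<phi> \<Longrightarrow> x \<notin> vars_tm t \<Longrightarrow> bounded_fm (AllN x (Imp (Less (Var x) t) \<phi>))"
| "bounded_fm \<phi> \<Longrightarrow> x \<notin> vars_tm t \<Longrightarrow> bounded_fm (ExN x (Conj (Less (Var x) t) \<phi>))"

definition Sigma01 :: "fm set" where
  "Sigma01 = {ExN x \<theta> | x \<theta>. bounded_fm \<theta>}"

definition Pi01 :: "fm set" where
  "Pi01 = {AllN x \<theta> | x \<theta>. bounded_fm \<theta>}"

definition basic_axioms :: "fm set" where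
  "basic_axioms =
    (let m = Var ''m''; n = Var ''n'' in
     {Neg (Eq (Add n One) Zero),
      Imp (Eq (Add m One) (Add n One)) (Eq m n),
      Eq (Add m Zero) m,
      Eq (Add m (Add n One)) (Add (Add m n) One),
      Eq (Mul m Zero) Zero,
      Eq (Mul m (Add n One)) (Add (Mul m n) m),
      Neg (Less m Zero),
      Iff (Less m (Add n One)) (Disj (Less m n) (Eq m n))})"

text \<open>The side condition on the induction formula only concerns the names of its bound variables.\<close>

definition Sigma01_induction :: "fm set" where
  "Sigma01_induction =
    {Imp (Conj (substN n Zero \<phi>) (AllN n (Imp \<phi> (substN n (Add (Var n) One) \<phi>)))) (AllN n \<phi>)
     | n \<phi>. \<phi> \<in> Sigma01 \<and> free_forN (Add (Var n) One) n \<phi>}"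

definition Delta01_comprehension :: "fm set" where
  "Delta01_comprehension =
    {Imp (AllN n (Iff \<phi> \<psi>)) (ExS X (AllN n (Iff (Mem (Var n) X) \<phi>)))
     | n X \<phi> \<psi>. \<phi> \<in> Sigma01 \<and> \<psi> \<in> Pi01 \<and> X \<notin> freeS \<phi>}"

definition RCA0 :: "fm set" where
  "RCA0 = basic_axioms \<union> Sigma01_induction \<union> Delta01_comprehension"

section \<open>The principles\<close>

text \<open>Functions and relations are sets of codes, with Simpson's pairing
  \<open>(i, j) = (i + j)\<^sup>2 + i\<close>; a function \<open>\<nat> \<times> \<nat> \<rightarrow> \<nat>\<close> is a set of codes \<open>((x, s), y)\<close>.

  The schemes below bind number variables by name. Names starting with an underscore are reserved
  for variables bound inside a scheme, so that no argument of a scheme is captured: every argument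
  term must be free of the underscored names bound in that scheme.\<close>

definition Pr :: "tm \<Rightarrow> tm \<Rightarrow> tm" where
  "Pr s t = Add (Mul (Add s t) (Add s t)) s"

definition Ap1 :: "string \<Rightarrow> tm \<Rightarrow> tm \<Rightarrow> fm" \<comment> \<open>\<open>F(x) = y\<close>\<close> where
  "Ap1 F x y = Mem (Pr x y) F"

definition Ap2 :: "string \<Rightarrow> tm \<Rightarrow> tm \<Rightarrow> tm \<Rightarrow> fm" \<comment> \<open>\<open>F(x, s) = y\<close>\<close> where
  "Ap2 F x s y = Mem (Pr (Pr x s) y) F"

definition Fun1 :: "string \<Rightarrow> fm" \<comment> \<open>\<open>F : \<nat> \<rightarrow> \<nat>\<close>\<close> where
  "Fun1 F =
    (let n = Var ''_n''; x = Var ''_x''; y = Var ''_y''; z = Var ''_z'' in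
     Conj
      (AllN ''_n'' (Imp (Mem n F) (ExNs [''_x'', ''_y''] (Eq n (Pr x y)))))
      (AllN ''_x'' (ExN ''_y''
        (Conj (Ap1 F x y) (AllN ''_z'' (Imp (Ap1 F x z) (Eq z y)))))))"

definition Fun2 :: "string \<Rightarrow> fm" \<comment> \<open>\<open>F : \<nat> \<times> \<nat> \<rightarrow> \<nat>\<close>\<close> where
  "Fun2 F =
    (let n = Var ''_n''; x = Var ''_x''; s = Var ''_s''; y = Var ''_y''; z = Var ''_z'' in
     Conj
      (AllN ''_n'' (Imp (Mem n F) (ExNs [''_x'', ''_s'', ''_y''] (Eq n (Pr (Pr x s) y)))))
      (AllNs [''_x'', ''_s''] (ExN ''_y''
        (Conj (Ap2 F x s y) (AllN ''_z'' (Imp (Ap2 F x s z) (Eq z y)))))))"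

definition Infinite :: "string \<Rightarrow> fm" where
  "Infinite X =
    (let m = Var ''_m''; n = Var ''_n'' in
     AllN ''_n'' (ExN ''_m'' (Conj (Less n m) (Mem m X))))"

definition Lim :: "string \<Rightarrow> tm \<Rightarrow> tm \<Rightarrow> fm" \<comment> \<open>\<open>lim\<^sub>s F(x, s) = y\<close>\<close> where
  "Lim F x y =
    (let s = Var ''_s''; t = Var ''_t'' in
     ExN ''_s'' (AllN ''_t'' (Imp (Leq s t) (Ap2 F x t y))))"

definition LimNonDecreasingOn :: "string \<Rightarrow> string \<Rightarrow> fm" where
  "LimNonDecreasingOn F X =
    (let x = Var ''_x''; y = Var ''_y''; u = Var ''_u''; v = Var ''_v'' in
     AllNs [''_x'', ''_y''] (Imp (Conjs [Mem x X, Mem y X, Less x y])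
       (ExNs [''_u'', ''_v''] (Conjs [Lim F x u, Lim F y v, Leq u v]))))"

definition LNS :: fm where
  "LNS =
    (let x = Var ''x''; s = Var ''s''; y = Var ''y''; z = Var ''z'' in
     AllS ''F'' (Imp
      (Conj (Fun2 ''F'')
        (AllNs [''x'', ''s'', ''y'', ''z'']
          (Imp (Conj (Ap2 ''F'' x (Add s One) y) (Ap2 ''F'' x s z)) (Leq y z))))
      (ExS ''X'' (Conj (Infinite ''X'') (LimNonDecreasingOn ''F'' ''X'')))))"

definition CNS :: fm where
  "CNS =
    (let x = Var ''x''; y = Var ''y''; z = Var ''z'' in
     AllS ''F'' (AllS ''B'' (Imp
      (Conjs [Fun2 ''F'', Fun1 ''B'',
        AllN ''x'' (ExN ''y'' (Lim ''F'' x y)),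
        AllNs [''x'', ''y'', ''z''] (Imp (Conj (Lim ''F'' x y) (Ap1 ''B'' x z)) (Leq y z))])
      (ExS ''X'' (Conj (Infinite ''X'') (LimNonDecreasingOn ''F'' ''X''))))))"

definition LinearOrder :: "string \<Rightarrow> string \<Rightarrow> fm" where
  "LinearOrder L R =
    (let n = Var ''_n''; x = Var ''_x''; y = Var ''_y''; z = Var ''_z'' in
     Conjs
      [AllN ''_n'' (Imp (Mem n R)
         (ExNs [''_x'', ''_y''] (Conjs [Eq n (Pr x y), Mem x L, Mem y L]))),
       AllN ''_x'' (Neg (Mem (Pr x x) R)),
       AllNs [''_x'', ''_y'', ''_z'']
         (Imp (Conj (Mem (Pr x y) R) (Mem (Pr y z) R)) (Mem (Pr x z) R)),
       AllNs [''_x'', ''_y''] (Imp (Conj (Mem x L) (Mem y L))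
         (Disj (Mem (Pr x y) R) (Disj (Eq x y) (Mem (Pr y x) R))))])"

text \<open>Finiteness of a set of numbers is boundedness, as for \<^const>\<open>Infinite\<close>.\<close>

definition Stable :: "string \<Rightarrow> string \<Rightarrow> fm" where
  "Stable L R =
    (let b = Var ''_b''; x = Var ''_x''; y = Var ''_y'' in
     AllN ''_x'' (Imp (Mem x L)
      (Disj
        (ExN ''_b'' (AllN ''_y'' (Imp (Conj (Mem y L) (Mem (Pr y x) R)) (Less y b))))
        (ExN ''_b'' (AllN ''_y'' (Imp (Conj (Mem y L) (Mem (Pr x y) R)) (Less y b)))))))"

definition SequenceIn :: "string \<Rightarrow> string \<Rightarrow> fm" \<comment> \<open>\<open>A : \<nat> \<rightarrow> L\<close>\<close> where
  "SequenceIn A L =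
    (let x = Var ''_x''; y = Var ''_y'' in
     Conj (Fun1 A) (AllNs [''_x'', ''_y''] (Imp (Ap1 A x y) (Mem y L))))"

definition Ascending :: "string \<Rightarrow> string \<Rightarrow> fm" where
  "Ascending A R =
    (let i = Var ''_i''; j = Var ''_j''; u = Var ''_u''; v = Var ''_v'' in
     AllNs [''_i'', ''_j'', ''_u'', ''_v'']
      (Imp (Conjs [Less i j, Ap1 A i u, Ap1 A j v]) (Mem (Pr u v) R)))"

definition Descending :: "string \<Rightarrow> string \<Rightarrow> fm" where
  "Descending A R =
    (let i = Var ''_i''; j = Var ''_j''; u = Var ''_u''; v = Var ''_v'' in
     AllNs [''_i'', ''_j'', ''_u'', ''_v'']
      (Imp (Conjs [Less i j, Ap1 A i u, Ap1 A j v]) (Mem (Pr v u) R)))"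

definition SADS :: fm where
  "SADS =
    AllS ''L'' (AllS ''R'' (Imp
      (Conjs [Infinite ''L'', LinearOrder ''L'' ''R'', Stable ''L'' ''R''])
      (ExS ''A'' (Conj (SequenceIn ''A'' ''L'')
        (Disj (Ascending ''A'' ''R'') (Descending ''A'' ''R''))))))"

end

theory Submission
  imports Defs "HOL-Library.Countable" "HOL-Library.Infinite_Set"
begin

text \<open>Both principles fail in one \<open>\<omega>\<close>-model of \<open>RCA\<^sub>0 + LNS\<close>. It contains a generic stable linear
  order of type \<open>\<omega> + \<omega>*\<close> for which the cut \<open>A\<close> and its complement are both hyperimmune, and it is
  closed under solutions of \<open>LNS\<close> that preserve these two hyperimmunities. If infinitely many of the
  limits of an instance lie below some bound, the least such bound is eventually a lower bound, so
  an infinite set on which the limit is constant is enumerable, and a solution is computable. If the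
  limits diverge, every finite nondecreasing stem can be extended far out, and Mathias forcing applies:
  the unknown limit function is one of the compactly many functions below \<open>\<lambda>x. f x 0\<close>, so one can ask
  about all of them at once. An infinite subset of \<open>A\<close> or of its complement is never added, while
  solutions of \<open>SADS\<close> for the order, and of \<open>CNS\<close> for the characteristic function of \<open>A\<close>, are such
  sets up to computation.\<close>

section \<open>Soundness for \<open>\<omega>\<close>-models\<close>

text \<open>The difference between LNS and CNS lies in the bounded case. Because the approximations
  only decrease, "the limit at \<open>x\<close> is at most \<open>v\<close>" is an enumerable
  property; for the characteristic function of \<open>A\<close> it is not, although that function is
  bounded by 1.

  To exclude solutions, immunity of \<open>A\<close> and of its complement would do, but immunity is
  too weak to carry through the forcing. Asked about all functions below the bound, the question is
  open, but compactness then answers with one finite set containing a possibly different witness set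
  for each function. So the requirements have to speak of finite sets rather than numbers, which is
  hyperimmunity.

  The generic order is shown to the operators without its cut. The order on an initial segment
  leaves open on which side its new elements will fall, and this freedom makes both sides
  hyperimmune at once.\<close>

primrec tmval :: "(string \<Rightarrow> nat) \<Rightarrow> tm \<Rightarrow> nat" where
  "tmval e (Var x) = e x"
| "tmval e Zero = 0"
| "tmval e One = 1"
| "tmval e (Add s t) = tmval e s + tmval e t"
| "tmval e (Mul s t) = tmval e s * tmval e t"

primrec sat :: "nat set set \<Rightarrow> (string \<Rightarrow> nat) \<Rightarrow> (string \<Rightarrow> nat set) \<Rightarrow> fm \<Rightarrow> bool" where
  "sat M e E (Eq s t) \<longleftrightarrow> tmval e s = tmval e t"
| "sat M e E (Less s t) \<longleftrightarrow> tmval e s < tmval e t"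
| "sat M e E (Mem t X) \<longleftrightarrow> tmval e t \<in> E X"
| "sat M e E (Neg \<phi>) \<longleftrightarrow> \<not> sat M e E \<phi>"
| "sat M e E (Imp \<phi> \<psi>) \<longleftrightarrow> (sat M e E \<phi> \<longrightarrow> sat M e E \<psi>)"
| "sat M e E (AllN x \<phi>) \<longleftrightarrow> (\<forall>a. sat M (e(x := a)) E \<phi>)"
| "sat M e E (AllS X \<phi>) \<longleftrightarrow> (\<forall>S\<in>M. sat M e (E(X := S)) \<phi>)"

definition valid :: "nat set set \<Rightarrow> fm \<Rightarrow> bool" where
  "valid M \<phi> \<longleftrightarrow> (\<forall>e E. range E \<subseteq> M \<longrightarrow> sat M e E \<phi>)"

lemma tmval_cong: "(\<And>x. x \<in> vars_tm t \<Longrightarrow> e x = e' x) \<Longrightarrow> tmval e t = tmval e' t"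
  by (induction t) auto

lemma sat_cong:
  assumes "\<And>x. x \<in> freeN \<phi> \<Longrightarrow> e x = e' x" and "\<And>X. X \<in> freeS \<phi> \<Longrightarrow> E X = E' X"
  shows "sat M e E \<phi> \<longleftrightarrow> sat M e' E' \<phi>"
  using assms
proof (induction \<phi> arbitrary: e e' E E')
  case (Eq s t)
  then show ?case using tmval_cong[of s e e'] tmval_cong[of t e e'] by simp
next
  case (Less s t)
  then show ?case using tmval_cong[of s e e'] tmval_cong[of t e e'] by simp
next
  case (Mem t X)
  then show ?case using tmval_cong[of t e e'] by simp
next
  case (Neg \<phi>)
  have "sat M e E \<phi> \<longleftrightarrow> sat M e' E' \<phi>"
    by (rule Neg.IH) (use Neg.prems in auto)
  then show ?case by simp
next
  case (Imp \<phi> \<psi>)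
  have "sat M e E \<phi> \<longleftrightarrow> sat M e' E' \<phi>" "sat M e E \<psi> \<longleftrightarrow> sat M e' E' \<psi>"
    by (rule Imp.IH; use Imp.prems in auto)+
  then show ?case by simp
next
  case (AllN x \<phi>)
  have "sat M (e(x := a)) E \<phi> \<longleftrightarrow> sat M (e'(x := a)) E' \<phi>" for a
    by (rule AllN.IH) (use AllN.prems in auto)
  then show ?case by simp
next
  case (AllS X \<phi>)
  have "sat M e (E(X := S)) \<phi> \<longleftrightarrow> sat M e' (E'(X := S)) \<phi>" for S
    by (rule AllS.IH) (use AllS.prems in auto)
  then show ?case by simp
qed

lemma tmval_subst: "tmval e (subst_tm x t s) = tmval (e(x := tmval e t)) s"
  by (induction s) auto

lemma subst_tm_fresh: "x \<notin> vars_tm s \<Longrightarrow> subst_tm x t s = s"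
  by (induction s) auto

lemma substN_fresh: "x \<notin> freeN \<phi> \<Longrightarrow> substN x t \<phi> = \<phi>"
  by (induction \<phi>) (auto simp: subst_tm_fresh)

lemma substS_fresh: "X \<notin> freeS \<phi> \<Longrightarrow> substS X Y \<phi> = \<phi>"
  by (induction \<phi>) auto

lemma sat_substN:
  "free_forN t x \<phi> \<Longrightarrow> sat M e E (substN x t \<phi>) \<longleftrightarrow> sat M (e(x := tmval e t)) E \<phi>"
proof (induction \<phi> arbitrary: e E)
  case (AllN y \<phi>)
  show ?case
  proof (cases "x \<in> freeN (AllN y \<phi>)")
    case False
    then have "substN x t (AllN y \<phi>) = AllN y \<phi>" by (rule substN_fresh)
    moreover have "sat M e E (AllN y \<phi>) \<longleftrightarrow> sat M (e(x := tmval e t)) E (AllN y \<phi>)"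
      by (rule sat_cong) (use False in auto)
    ultimately show ?thesis by (simp only:)
  next
    case True
    then have y: "y \<notin> vars_tm t" "free_forN t x \<phi>" "x \<noteq> y" using AllN.prems by auto
    have "tmval (e(y := a)) t = tmval e t" for a
      by (rule tmval_cong) (use y in auto)
    have "sat M e E (substN x t (AllN y \<phi>)) \<longleftrightarrow> (\<forall>a. sat M (e(y := a, x := tmval e t)) E \<phi>)"
      using not_sym[OF y(3)] by (simp only: substN.simps sat.simps AllN.IH[OF y(2)] \<open>\<And>a. tmval (e(y := a)) t = tmval e t\<close> if_False simp_thms)
    also have "\<dots> \<longleftrightarrow> (\<forall>a. sat M (e(x := tmval e t, y := a)) E \<phi>)"
      by (simp only: fun_upd_twist[OF y(3)])
    finally show ?thesis by (simp only: sat.simps)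
  qed
qed (auto simp: tmval_subst)

lemma sat_substS:
  "free_forS Y X \<phi> \<Longrightarrow> sat M e E (substS X Y \<phi>) \<longleftrightarrow> sat M e (E(X := E Y)) \<phi>"
proof (induction \<phi> arbitrary: e E)
  case (AllS Z \<phi>)
  show ?case
  proof (cases "X \<in> freeS (AllS Z \<phi>)")
    case False
    then have "substS X Y (AllS Z \<phi>) = AllS Z \<phi>" by (rule substS_fresh)
    moreover have "sat M e E (AllS Z \<phi>) \<longleftrightarrow> sat M e (E(X := E Y)) (AllS Z \<phi>)"
      by (rule sat_cong) (use False in auto)
    ultimately show ?thesis by (simp only:)
  next
    case True
    then have Z: "Z \<noteq> Y" "free_forS Y X \<phi>" "X \<noteq> Z" using AllS.prems by auto
    have "sat M e E (substS X Y (AllS Z \<phi>)) \<longleftrightarrow> (\<forall>S\<in>M. sat M e (E(Z := S, X := E Y)) \<phi>)"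
      using not_sym[OF Z(3)] not_sym[OF Z(1)]
      by (simp only: substS.simps sat.simps AllS.IH[OF Z(2)] if_False simp_thms fun_upd_other)
    also have "\<dots> \<longleftrightarrow> (\<forall>S\<in>M. sat M e (E(X := E Y, Z := S)) \<phi>)"
      by (simp only: fun_upd_twist[OF Z(3)])
    finally show ?thesis by (simp only: sat.simps)
  qed
qed auto

lemma soundness:
  assumes "\<Gamma> \<turnstile> \<phi>" and ax: "\<And>\<gamma>. \<gamma> \<in> \<Gamma> \<Longrightarrow> valid M \<gamma>"
  shows "valid M \<phi>"
  using assms(1)
proof (induction rule: provable.induct)
  case (MP \<phi> \<psi>)
  then show ?case by (simp add: valid_def)
next
  case (GenS \<phi> X)
  have "range (E(X := S)) \<subseteq> M" if "range E \<subseteq> M" "S \<in> M" for E S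
    using that by auto
  then show ?case using GenS.IH by (simp add: valid_def)
next
  case (InstN t x \<phi>)
  then show ?case by (simp add: valid_def sat_substN)
next
  case (InstS Y X \<phi>)
  then show ?case by (auto simp: valid_def sat_substS)
next
  case (DistN x \<phi> \<psi>)
  then have "sat M (e(x := a)) E \<phi> \<longleftrightarrow> sat M e E \<phi>" for e E a
    by (intro sat_cong) auto
  then show ?case by (simp add: valid_def)
next
  case (DistS X \<phi> \<psi>)
  then have "sat M e (E(X := S)) \<phi> \<longleftrightarrow> sat M e E \<phi>" for e E S
    by (intro sat_cong) auto
  then show ?case by (simp add: valid_def)
next
  case (Leibniz s x \<phi> t)
  then show ?case by (simp add: valid_def sat_substN)
qed (use ax in \<open>auto simp: valid_def\<close>)

lemma valid_basic_axioms: "\<gamma> \<in> basic_axioms \<Longrightarrow> valid M \<gamma>"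
  by (auto simp: basic_axioms_def Let_def valid_def)

lemma valid_Sigma01_induction:
  assumes "\<gamma> \<in> Sigma01_induction"
  shows "valid M \<gamma>"
proof -
  obtain n \<phi> where \<gamma>: "\<gamma> = Imp (Conj (substN n Zero \<phi>)
      (AllN n (Imp \<phi> (substN n (Add (Var n) One) \<phi>)))) (AllN n \<phi>)"
    and free: "free_forN (Add (Var n) One) n \<phi>"
    using assms by (auto simp: Sigma01_induction_def)
  have zero: "free_forN Zero n \<chi>" for \<chi>
    by (induction \<chi>) auto
  show ?thesis
    unfolding valid_def
  proof (intro allI impI)
    fix e and E :: "string \<Rightarrow> nat set"
    have "sat M (e(n := a)) E \<phi>"
      if "sat M (e(n := 0)) E \<phi>" and "\<And>a. sat M (e(n := a)) E \<phi> \<Longrightarrow> sat M (e(n := Suc a)) E \<phi>" for a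
      using that by (induction a) auto
    then show "sat M e E \<gamma>"
      by (auto simp: \<gamma> sat_substN[OF free] sat_substN[OF zero])
  qed
qed

section \<open>Enumeration operators with finite use\<close>

type_synonym env = "nat \<Rightarrow> nat set"

definition agree :: "nat \<Rightarrow> env \<Rightarrow> env \<Rightarrow> bool" where
  "agree N Y Y' \<longleftrightarrow> (\<forall>i<N. \<forall>x<N. x \<in> Y i \<longleftrightarrow> x \<in> Y' i)"

text \<open>Continuity at one environment only: comprehension has finite use where its two
  definitions agree, and a search has finite use where it terminates.\<close>

definition cont_at :: "(env \<Rightarrow> env) \<Rightarrow> env \<Rightarrow> bool" where
  "cont_at T Y \<longleftrightarrow> (\<forall>N. \<exists>K. \<forall>Y'. agree K Y Y' \<longrightarrow> agree N (T Y) (T Y'))"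

definition interior :: "(env \<Rightarrow> bool) \<Rightarrow> env \<Rightarrow> bool" where
  "interior P Y \<longleftrightarrow> (\<exists>N. \<forall>Y'. agree N Y Y' \<longrightarrow> P Y')"

definition locally_const :: "(env \<Rightarrow> 'a) \<Rightarrow> env \<Rightarrow> bool" where
  "locally_const f Y \<longleftrightarrow> interior (\<lambda>Y'. f Y' = f Y) Y"

lemma agree_refl [simp]: "agree N Y Y"
  by (simp add: agree_def)

lemma agree_mono: "agree N Y Y' \<Longrightarrow> M \<le> N \<Longrightarrow> agree M Y Y'"
  by (auto simp: agree_def)

lemma agree_trans: "agree N Y Y' \<Longrightarrow> agree N Y' Y'' \<Longrightarrow> agree N Y Y''"
  by (auto simp: agree_def)

lemma agree_upd: "agree N Y Y' \<Longrightarrow> S \<inter> {..<N} = S' \<inter> {..<N} \<Longrightarrow> agree N (Y(k := S)) (Y'(k := S'))"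
  by (auto simp: agree_def)

lemma interiorI: "(\<And>Y'. agree N Y Y' \<Longrightarrow> P Y') \<Longrightarrow> interior P Y"
  by (auto simp: interior_def)

lemma interiorD: "interior P Y \<Longrightarrow> P Y"
  by (auto simp: interior_def)

lemma interior_interior: "interior P Y \<Longrightarrow> interior (interior P) Y"
  unfolding interior_def by (meson agree_trans)

lemma interior_mono: "interior P Y \<Longrightarrow> (\<And>Y'. P Y' \<Longrightarrow> Q Y') \<Longrightarrow> interior Q Y"
  by (auto simp: interior_def)

lemma interior_conj: "interior P Y \<Longrightarrow> interior Q Y \<Longrightarrow> interior (\<lambda>Y'. P Y' \<and> Q Y') Y"
proof -
  assume "interior P Y" "interior Q Y"
  then obtain M N where "\<forall>Y'. agree M Y Y' \<longrightarrow> P Y'" "\<forall>Y'. agree N Y Y' \<longrightarrow> Q Y'"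
    by (auto simp: interior_def)
  then show ?thesis
    by (intro interiorI[of "max M N"]) (meson agree_mono max.cobounded1 max.cobounded2)
qed

lemma interior_const: "P \<Longrightarrow> interior (\<lambda>_. P) Y"
  by (simp add: interior_def)

lemma interior_Ball:
  "finite E \<Longrightarrow> (\<And>x. x \<in> E \<Longrightarrow> interior (P x) Y) \<Longrightarrow> interior (\<lambda>Y'. \<forall>x\<in>E. P x Y') Y"
  by (induction E rule: finite_induct) (simp_all add: interior_const interior_conj)

lemma locally_const_mem: "locally_const (\<lambda>Y. x \<in> Y i) Y"
  unfolding locally_const_def
  by (rule interiorI[of "Suc (max x i)"]) (auto simp: agree_def less_Suc_eq_le)

lemma locally_const_lift:
  assumes "locally_const f Y"
  shows "locally_const (\<lambda>Y. h (f Y)) Y"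
  using assms unfolding locally_const_def by (rule interior_mono) simp

lemma locally_const_lift2:
  assumes "locally_const f Y" "locally_const g Y"
  shows "locally_const (\<lambda>Y. h (f Y) (g Y)) Y"
  using interior_conj[OF assms[unfolded locally_const_def]] unfolding locally_const_def
  by (rule interior_mono) simp

lemma locally_const_cong:
  assumes "locally_const g Y" "interior (\<lambda>Y'. f Y' = g Y') Y"
  shows "locally_const f Y"
  using interior_conj[OF assms(1)[unfolded locally_const_def] assms(2)] interiorD[OF assms(2)]
  unfolding locally_const_def by (auto elim!: interior_mono)

lemma locally_const_Ball:
  assumes "finite E" "\<And>x. x \<in> E \<Longrightarrow> locally_const (P x) Y"
  shows "locally_const (\<lambda>Y. \<forall>x\<in>E. P x Y) Y"
  using interior_Ball[of E "\<lambda>x Y'. P x Y' = P x Y" Y, OF assms[unfolded locally_const_def]]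
  unfolding locally_const_def by (auto elim!: interior_mono)

lemma interior_comp:
  assumes "cont_at T Y" "interior P (T Y)"
  shows "interior (\<lambda>Y. P (T Y)) Y"
proof -
  obtain N where N: "\<And>Y'. agree N (T Y) Y' \<Longrightarrow> P Y'" using assms(2) by (auto simp: interior_def)
  obtain K where "\<And>Y'. agree K Y Y' \<Longrightarrow> agree N (T Y) (T Y')"
    using assms(1) unfolding cont_at_def by blast
  then show ?thesis using N by (intro interiorI[of K]) blast
qed

lemma cont_atI:
  assumes "\<And>i x. locally_const (\<lambda>Y. x \<in> T Y i) Y"
  shows "cont_at T Y"
  unfolding cont_at_def
proof
  fix N
  have "interior (\<lambda>Y'. \<forall>p\<in>{..<N} \<times> {..<N}. (snd p \<in> T Y' (fst p)) = (snd p \<in> T Y (fst p))) Y"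
    by (rule interior_Ball) (use assms in \<open>auto simp: locally_const_def\<close>)
  then obtain K where K: "\<And>Y'. agree K Y Y' \<Longrightarrow>
      \<forall>p\<in>{..<N} \<times> {..<N}. (snd p \<in> T Y' (fst p)) = (snd p \<in> T Y (fst p))"
    unfolding interior_def by metis
  have "agree N (T Y) (T Y')" if "agree K Y Y'" for Y'
    unfolding agree_def
  proof (intro allI impI)
    fix i x assume "i < N" "x < N"
    then show "x \<in> T Y i \<longleftrightarrow> x \<in> T Y' i" using K[OF that, THEN bspec, of "(i, x)"] by simp
  qed
  then show "\<exists>K. \<forall>Y'. agree K Y Y' \<longrightarrow> agree N (T Y) (T Y')" by blast
qed

lemma cont_at_upd:
  assumes "\<And>x. locally_const (\<lambda>Y. x \<in> \<Phi> Y) Y"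
  shows "cont_at (\<lambda>Y. Y(k := \<Phi> Y)) Y"
proof (rule cont_atI)
  fix i x
  show "locally_const (\<lambda>Y. x \<in> (Y(k := \<Phi> Y)) i) Y"
    using assms[of x] locally_const_mem[of x i Y] by (cases "i = k") simp_all
qed

lemma cont_at_upd2:
  assumes "\<And>x. locally_const (\<lambda>Y. x \<in> \<Phi> Y) Y"
  shows "cont_at (\<lambda>Y. Y(k := \<Phi> Y, l := {})) Y"
proof (rule cont_atI)
  fix i x
  have "locally_const (\<lambda>Y. False) Y" by (simp add: locally_const_def interior_def)
  then show "locally_const (\<lambda>Y. x \<in> (Y(k := \<Phi> Y, l := {})) i) Y"
    using assms[of x] locally_const_mem[of x i Y] by (cases "i = l"; cases "i = k") simp_all
qed

section \<open>Compactness of Cantor space\<close>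

lemma cantor_compact:
  fixes R :: "nat \<Rightarrow> nat set \<Rightarrow> bool"
  assumes bar: "\<And>S. \<exists>m. \<forall>S'. S' \<inter> {..<m} = S \<inter> {..<m} \<longrightarrow> R m S'"
    and mono: "\<And>m n S. m \<le> n \<Longrightarrow> R m S \<Longrightarrow> R n S"
  shows "\<exists>m. \<forall>S. R m S"
proof (rule ccontr)
  assume not: "\<nexists>m. \<forall>S. R m S"
  \<comment> \<open>No single \<open>m\<close> serves all sets that agree with \<open>T\<close>
    below \<open>l\<close>. By monotonicity of \<open>R\<close>, bounds for the two halves of this
    cone would combine, so one half is bad again.\<close>
  define bad where "bad l T \<longleftrightarrow> (\<forall>m. \<exists>S. S \<inter> {..<l} = T \<inter> {..<l} \<and> \<not> R m S)" for l T
  have step: "bad (Suc l) T \<or> bad (Suc l) (insert l T)" if bad: "bad l T" and l: "l \<notin> T" for l T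
  proof (rule ccontr)
    assume "\<not> ?thesis"
    then have "\<not> bad (Suc l) T" "\<not> bad (Suc l) (insert l T)" by simp_all
    then obtain m n where m: "\<And>S. S \<inter> {..<Suc l} = T \<inter> {..<Suc l} \<Longrightarrow> R m S"
      and n: "\<And>S. S \<inter> {..<Suc l} = insert l T \<inter> {..<Suc l} \<Longrightarrow> R n S"
      unfolding bad_def not_all not_ex de_Morgan_conj not_not by metis
    obtain S where S: "S \<inter> {..<l} = T \<inter> {..<l}" "\<not> R (max m n) S"
      using bad unfolding bad_def by metis
    show False
    proof (cases "l \<in> S")
      case True
      then have "S \<inter> {..<Suc l} = insert l T \<inter> {..<Suc l}" using S(1) True by (auto simp: set_eq_iff less_Suc_eq)
      then have "R n S" by (rule n)
      then show False using S(2) mono[of n "max m n" S] by simp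
    next
      case False
      then have "S \<inter> {..<Suc l} = T \<inter> {..<Suc l}"
        using S(1) l False by (auto simp: set_eq_iff less_Suc_eq)
      then have "R m S" by (rule m)
      then show False using S(2) mono[of m "max m n" S] by simp
    qed
  qed
  have "\<exists>T. \<forall>l. (T l \<subseteq> {..<l} \<and> bad l (T l)) \<and> T (Suc l) \<inter> {..<l} = T l"
  proof (rule dependent_nat_choice)
    show "\<exists>T. T \<subseteq> {..<0} \<and> bad 0 T" using not by (intro exI[of _ "{}"]) (simp add: bad_def)
  next
    fix T l
    assume T: "T \<subseteq> {..<l} \<and> bad l T"
    have "l \<notin> T" using conjunct1[OF T] by auto
    then consider "bad (Suc l) T" | "bad (Suc l) (insert l T)"
      using step conjunct2[OF T] by metis
    then show "\<exists>T'. (T' \<subseteq> {..<Suc l} \<and> bad (Suc l) T') \<and> T' \<inter> {..<l} = T"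
    proof cases
      case 1
      moreover have "T \<subseteq> {..<Suc l}" "T \<inter> {..<l} = T" using conjunct1[OF T] by auto
      ultimately show ?thesis by blast
    next
      case 2
      moreover have "insert l T \<subseteq> {..<Suc l}" "insert l T \<inter> {..<l} = T"
        using conjunct1[OF T] by auto
      ultimately show ?thesis by blast
    qed
  qed
  then obtain T where "\<forall>l. (T l \<subseteq> {..<l} \<and> bad l (T l)) \<and> T (Suc l) \<inter> {..<l} = T l" ..
  then have T: "\<And>l. T l \<subseteq> {..<l}" "\<And>l. bad l (T l)" "\<And>l. T (Suc l) \<inter> {..<l} = T l"
    by simp_all
  have restr: "T (l + d) \<inter> {..<l} = T l" for l d
  proof (induction d)
    case 0
    then show ?case using T(1)[of l] by auto
  next
    case (Suc d)
    have "T (l + Suc d) \<inter> {..<l} = (T (Suc (l + d)) \<inter> {..<l + d}) \<inter> {..<l}" by auto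
    then show ?case using T(3)[of "l + d"] Suc by simp
  qed
  define S where "S = {x. x \<in> T (Suc x)}"
  have S: "S \<inter> {..<l} = T l" for l
  proof -
    have "x \<in> T (Suc x) \<longleftrightarrow> x \<in> T l" if "x < l" for x
      using restr[of "Suc x" "l - Suc x"] that by auto
    then show ?thesis using T(1)[of l] unfolding S_def by blast
  qed
  obtain m where m: "\<And>S'. S' \<inter> {..<m} = S \<inter> {..<m} \<Longrightarrow> R m S'" using bar[of S] by blast
  have "T m \<inter> {..<m} = S \<inter> {..<m}" using S[of m] T(1)[of m] by auto
  then show False using T(2)[of m, unfolded bad_def, THEN spec, of m] m by auto
qed

section \<open>Pairing, and countable codes for operators and enumerations\<close>

definition pr :: "nat \<Rightarrow> nat \<Rightarrow> nat" where
  "pr i j = (i + j) * (i + j) + i"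

lemma pr_inject [simp]: "pr i j = pr i' j' \<longleftrightarrow> i = i' \<and> j = j'"
proof
  assume eq: "pr i j = pr i' j'"
  have less: "pr a b < pr c d" if "a + b < c + d" for a b c d
  proof -
    have "pr a b < Suc (a + b) * Suc (a + b)" by (simp add: pr_def)
    also have "\<dots> \<le> (c + d) * (c + d)" by (rule mult_le_mono) (use that in auto)
    also have "\<dots> \<le> pr c d" by (simp add: pr_def)
    finally show ?thesis .
  qed
  have "i + j = i' + j'"
    by (rule linorder_cases[of "i + j" "i' + j'"]) (use less[of i j i' j'] less[of i' j' i j] eq in auto)
  then show "i = i' \<and> j = j'" using eq by (simp add: pr_def)
qed simp

lemma le_pr1: "i \<le> pr i j"
  by (simp add: pr_def)

lemma le_pr2: "j \<le> pr i j"
proof -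
  have "i + j \<le> (i + j) * (i + j)" by (rule le_square)
  then show ?thesis unfolding pr_def by linarith
qed

definition lookup :: "('a \<times> nat) list \<Rightarrow> 'a \<Rightarrow> nat" where
  "lookup xs x = (case map_of xs x of None \<Rightarrow> 0 | Some i \<Rightarrow> i)"

text \<open>Column \<open>H\<close> is the graph of a function \<open>f\<close> of two arguments. Any \<open>S\<close> whatsoever then codes a
  function below \<open>\<lambda>x. f x 0\<close>, which makes the compactness of Cantor space applicable to such
  functions.\<close>

definition coded_fun :: "nat set \<Rightarrow> nat set \<Rightarrow> nat \<Rightarrow> nat" where
  "coded_fun H S x = (LEAST v. pr x v \<notin> S \<or> pr (pr x 0) v \<in> H)"

text \<open>\<open>Compr\<close> serves comprehension, \<open>Full\<close> is the initial reservoir,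
  and \<open>Enum\<close> solves the bounded case of LNS. \<open>Ones\<close> and
  \<open>Stages\<close> are the bound and the instance for CNS: column 0 holds the order, and stage
  \<open>s\<close> guesses \<open>x \<in> A\<close> from whether \<open>x\<close> precedes
  \<open>s\<close>.\<close>

datatype opr =
    Compr string string fm string fm "(string \<times> nat) list" "(string \<times> nat) list"
  | Full
  | Ones
  | Stages
  | Enum nat nat nat

text \<open>\<open>Enum\<close> puts in \<open>x\<close> if \<open>x\<close> itself is low at the
  first stage \<open>s\<close> at which anything in \<open>{x..s}\<close> is low. Membership is thus
  settled once any element from \<open>x\<close> on shows up, as in the proof that an infinite
  enumerable set has an infinite decidable subset.\<close>

primrec val :: "opr \<Rightarrow> env \<Rightarrow> nat set" where
  "val (Compr n x \<theta> y \<eta> es ls) = (\<lambda>Y.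
     {a. \<exists>u. sat {} ((lookup es)(n := a, x := u)) (\<lambda>X. Y (lookup ls X)) \<theta> \<and>
       (\<forall>v<u. sat {} ((lookup es)(n := a, y := v)) (\<lambda>X. Y (lookup ls X)) \<eta>)})"
| "val Full = (\<lambda>Y. UNIV)"
| "val Ones = (\<lambda>Y. {pr x 1 | x. True})"
| "val Stages = (\<lambda>Y. {pr (pr x s) (if pr x s \<in> Y 0 then 1 else 0) | x s. True})"
| "val (Enum j v b) = (\<lambda>Y.
     {x. b \<le> x \<and> (\<exists>s\<ge>x. (\<exists>u\<le>v. pr (pr x s) u \<in> Y j) \<and>
        (\<forall>s'<s. \<forall>y\<in>{x..s'}. \<forall>u\<le>v. pr (pr y s') u \<notin> Y j))})"

datatype trans = Put nat opr | Records nat nat | Level nat nat nat | Tail nat nat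

text \<open>Column \<open>k\<close> is a reservoir and column \<open>Suc k\<close> selects a
  function below the bound. Running maxima and fibres are the two kinds of subset on which that
  function is nondecreasing; the selector is erased afterwards, so its column can be used
  again.\<close>

primrec act :: "trans \<Rightarrow> env \<Rightarrow> env" where
  "act (Put k p) = (\<lambda>Y. Y(k := val p Y))"
| "act (Records j k) = (\<lambda>Y. Y(k := {z \<in> Y k. \<forall>y\<in>Y k. y < z \<longrightarrow>
     coded_fun (Y j) (Y (Suc k)) y \<le> coded_fun (Y j) (Y (Suc k)) z}, Suc k := {}))"
| "act (Level j k v) = (\<lambda>Y. Y(k := {z \<in> Y k. coded_fun (Y j) (Y (Suc k)) z = v}, Suc k := {}))"
| "act (Tail k m) = (\<lambda>Y. Y(k := Y k \<inter> {m..}))"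

text \<open>The codes ending in \<open>U\<close> enumerate finite sets that work for every choice of
  an auxiliary \<open>S\<close>. Those ending in \<open>C\<close> are open conditions on one
  \<open>S\<close>; their complements are the closed classes left when the uniform question fails
  beyond \<open>n\<close>.\<close>

datatype code =
    Elem nat nat
  | Val nat
  | Sub trans code
  | PathU nat code code
  | PathC nat code code
  | StepU nat nat "nat list" code
  | StepC nat nat "nat list" nat code

text \<open>Semantic operators stand in for relative computability: all that the forcing constructions need
  is that the family is countable, that its members are open in the environment, and that it is closed
  under the operations occurring in the proofs. In \<open>PathC\<close> and \<open>StepC\<close> the second argument is a
  dummy: they code open sets of environments.\<close>

primrec sem :: "code \<Rightarrow> env \<Rightarrow> nat set \<Rightarrow> bool" where
  "sem (Elem j n) = (\<lambda>Y D. interior (\<lambda>Y. \<exists>x\<ge>n. D = {x} \<and> x \<in> Y j) Y)"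
| "sem (Val j) = (\<lambda>Y D. interior (\<lambda>Y. \<exists>i x. D = {x} \<and> pr i x \<in> Y j) Y)"
| "sem (Sub t w) = (\<lambda>Y D. interior (\<lambda>Y. sem w (act t Y) D) Y)"
| "sem (PathU k c w) = (\<lambda>Y D. interior (\<lambda>Y. \<forall>S. sem c (Y(k := S)) {} \<or>
     (\<exists>D'\<subseteq>D. sem w (Y(k := S)) D')) Y)"
| "sem (PathC n c w) = (\<lambda>Y D. interior (\<lambda>Y. sem c Y {} \<or> (\<exists>m. \<exists>D'\<subseteq>{n..m}. sem w Y D')) Y)"
| "sem (StepU j k xs w) = (\<lambda>Y D. interior (\<lambda>Y. \<forall>S. \<exists>E. finite E \<and> E \<subseteq> Y k \<and>
     mono_on E (coded_fun (Y j) S) \<and>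
     (\<exists>D'\<subseteq>D. sem w (Y(k := set xs \<union> E, Suc k := {})) D')) Y)"
| "sem (StepC j k xs n w) = (\<lambda>Y D. interior (\<lambda>Y. \<exists>E m. finite E \<and> E \<subseteq> Y k \<and>
     mono_on E (coded_fun (Y j) (Y (Suc k))) \<and>
     (\<exists>D'\<subseteq>{n..m}. sem w (Y(k := set xs \<union> E, Suc k := {})) D')) Y)"

instance char :: countable by countable_datatype
instance tm :: countable by countable_datatype
instance fm :: countable by countable_datatype
instance opr :: countable by countable_datatype
instance trans :: countable by countable_datatype
instance code :: countable by countable_datatype

text \<open>Each clause of \<open>sem\<close> is wrapped in \<open>interior\<close>, so openness
  holds by construction, even where a transformation is discontinuous. Every use then has to show
  that the wrapper loses nothing at the environment at hand.\<close>

lemma sem_interior: "sem w Y D \<Longrightarrow> interior (\<lambda>Y. sem w Y D) Y"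
  by (cases w) (simp_all only: sem.simps interior_interior)

text \<open>The premise describes an array of finite sets with unbounded minima. For
  \<open>B = A\<close> the conclusion says that not all members of the array meet the complement of
  \<open>A\<close>, which is hyperimmunity of that complement.\<close>

definition req :: "nat set \<Rightarrow> code \<Rightarrow> env \<Rightarrow> bool" where
  "req B w Y \<longleftrightarrow> (\<forall>n. \<exists>m. \<exists>D\<subseteq>{n..m}. sem w Y D) \<longrightarrow> (\<exists>D\<subseteq>B. sem w Y D)"

text \<open>This says that both \<open>A\<close> and its complement are hyperimmune relative to \<open>Y\<close>.\<close>

definition good :: "nat set \<Rightarrow> env \<Rightarrow> bool" where
  "good A Y \<longleftrightarrow> (\<forall>w. req A w Y \<and> req (- A) w Y)"

lemma goodD:
  assumes "good A Y" "\<And>n. \<exists>m. \<exists>D\<subseteq>{n..m}. sem w Y D" "B = A \<or> B = - A"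
  obtains D where "D \<subseteq> B" "sem w Y D"
proof -
  have "req B w Y" using assms(1,3) by (auto simp: good_def)
  then have "\<exists>D\<subseteq>B. sem w Y D" using assms(2) by (simp add: req_def)
  then show ?thesis using that by blast
qed

text \<open>What \<open>w\<close> enumerates from \<open>act t Y\<close>, the code
  \<open>Sub t w\<close> enumerates from \<open>Y\<close>; continuity at \<open>Y\<close> makes the
  \<open>interior\<close> in \<open>Sub\<close> harmless.\<close>

lemma good_act:
  assumes "good A Y" "cont_at (act t) Y"
  shows "good A (act t Y)"
proof -
  have Sub: "sem (Sub t w) Y D \<longleftrightarrow> sem w (act t Y) D" for w D
    using interior_comp[OF assms(2) sem_interior[of w _ D]] interiorD[of "\<lambda>Y. sem w (act t Y) D" Y]
    by auto
  show ?thesis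
    using assms(1) unfolding good_def req_def Sub[symmetric] by blast
qed

text \<open>One number serves both as the index of \<open>P\<close> and as the radius of agreement
  with \<open>Y\<close>. Enlarging it helps in both roles, so \<open>cantor_compact\<close> applies
  and gives a neighbourhood of \<open>Y\<close> uniform in \<open>S\<close>.\<close>

lemma compact_env:
  fixes P :: "nat \<Rightarrow> env \<Rightarrow> bool"
  assumes int: "\<And>S. \<exists>m. interior (P m) (Y(k := S))"
    and mono: "\<And>m n Y. m \<le> n \<Longrightarrow> P m Y \<Longrightarrow> P n Y"
  shows "\<exists>m. interior (\<lambda>Y. \<forall>S. P m (Y(k := S))) Y"
proof -
  define R where "R m S \<longleftrightarrow> (\<forall>Y'. agree m Y Y' \<longrightarrow> P m (Y'(k := S)))" for m S
  have "\<exists>m. \<forall>S. R m S"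
  proof (rule cantor_compact)
    fix S
    obtain m N where N: "\<And>Y'. agree N (Y(k := S)) Y' \<Longrightarrow> P m Y'"
      using int[of S] unfolding interior_def by blast
    have "R (max m N) S'" if S': "S' \<inter> {..<max m N} = S \<inter> {..<max m N}" for S'
      unfolding R_def
    proof (intro allI impI)
      fix Y' assume "agree (max m N) Y Y'"
      then have "agree (max m N) (Y(k := S)) (Y'(k := S'))" using S' by (intro agree_upd) auto
      then have "agree N (Y(k := S)) (Y'(k := S'))" by (rule agree_mono) simp
      then have "P m (Y'(k := S'))" by (rule N)
      then show "P (max m N) (Y'(k := S'))" using mono by (meson max.cobounded1)
    qed
    then show "\<exists>m. \<forall>S'. S' \<inter> {..<m} = S \<inter> {..<m} \<longrightarrow> R m S'" by blast
  next
    fix m n S assume "m \<le> n" "R m S"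
    then show "R n S" unfolding R_def by (meson agree_mono mono)
  qed
  then obtain m where "\<forall>S. R m S" ..
  then show ?thesis unfolding R_def by (intro exI[of _ m] interiorI[of m]) blast
qed

text \<open>The analogue of the hyperimmune-free basis theorem.\<close>

lemma good_path:
  assumes good: "good A Y" and ne: "\<exists>S. \<not> sem c (Y(k := S)) {}"
  obtains S where "\<not> sem c (Y(k := S)) {}" "good A (Y(k := S))"
proof -
  let ?ne = "\<lambda>c. \<exists>S. \<not> sem c (Y(k := S)) {}"
  let ?Q = "\<lambda>w c c'. \<forall>S. \<not> sem c' (Y(k := S)) {} \<longrightarrow>
    \<not> sem c (Y(k := S)) {} \<and> req A w (Y(k := S)) \<and> req (- A) w (Y(k := S))"
  have step: "\<exists>c'. ?ne c' \<and> ?Q w c c'" if ne: "?ne c" for c w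
  proof (cases "\<forall>n. \<exists>m. \<exists>D\<subseteq>{n..m}. sem (PathU k c w) Y D")
    \<comment> \<open>One \<open>D \<subseteq> B\<close> then serves every \<open>S\<close> in the
      class, so the class already meets the requirement and is kept.\<close>
    case True
    have "\<exists>D\<subseteq>B. sem w (Y(k := S)) D" if S: "\<not> sem c (Y(k := S)) {}" and B: "B = A \<or> B = - A" for S B
    proof -
      obtain D where D: "D \<subseteq> B" "sem (PathU k c w) Y D"
        using goodD[OF good _ B, of "PathU k c w"] True by blast
      then have "\<forall>S. sem c (Y(k := S)) {} \<or> (\<exists>D'\<subseteq>D. sem w (Y(k := S)) D')"
        using interiorD by simp
      then show ?thesis using S D(1) by (meson subset_trans)
    qed
    then have "?Q w c c" by (simp add: req_def)
    then show ?thesis using ne by blast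
  next
    case False
    \<comment> \<open>Beyond \<open>n\<close> no finite set serves the whole class. Restrict to the
      \<open>S\<close> for which \<open>w\<close> enumerates nothing beyond \<open>n\<close>: there
      the premise of the requirement fails, and by compactness this smaller class is
      nonempty.\<close>
    then obtain n where n: "\<And>m D. D \<subseteq> {n..m} \<Longrightarrow> \<not> sem (PathU k c w) Y D" by blast
    let ?P = "\<lambda>m Y. sem c Y {} \<or> (\<exists>D'\<subseteq>{n..m}. sem w Y D')"
    have PathC: "sem (PathC n c w) Y' {} \<longleftrightarrow> (\<exists>m. ?P m Y')" for Y'
    proof
      assume "\<exists>m. ?P m Y'"
      then consider "sem c Y' {}" | m D' where "D' \<subseteq> {n..m}" "sem w Y' D'" by blast
      then show "sem (PathC n c w) Y' {}"
      proof cases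
        case 1
        show ?thesis unfolding sem.simps by (rule interior_mono[OF sem_interior[OF 1]]) simp
      next
        case 2
        show ?thesis unfolding sem.simps
          by (rule interior_mono[OF sem_interior[OF 2(2)]]) (use 2(1) in blast)
      qed
    qed (use interiorD in auto)
    have "?ne (PathC n c w)"
    proof (rule ccontr)
      assume "\<not> ?thesis"
      then have all: "\<exists>m. ?P m (Y(k := S))" for S using PathC by blast
      have "\<exists>m. interior (\<lambda>Y. \<forall>S. ?P m (Y(k := S))) Y"
      proof (rule compact_env)
        fix S
        from all[of S] obtain m where "?P m (Y(k := S))" ..
        then consider "sem c (Y(k := S)) {}" | D' where "D' \<subseteq> {n..m}" "sem w (Y(k := S)) D'" by blast
        then have "interior (?P m) (Y(k := S))"
        proof cases
          case 1
          show ?thesis by (rule interior_mono[OF sem_interior[OF 1]]) simp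
        next
          case 2
          show ?thesis by (rule interior_mono[OF sem_interior[OF 2(2)]]) (use 2(1) in blast)
        qed
        then show "\<exists>m. interior (?P m) (Y(k := S))" ..
      next
        fix m m' :: nat and Y assume "m \<le> m'" "?P m Y"
        moreover have "{n..m} \<subseteq> {n..m'}" using \<open>m \<le> m'\<close> by auto
        ultimately show "?P m' Y" by (meson subset_trans)
      qed
      then obtain m where "sem (PathU k c w) Y {n..m}" by auto
      then show False using n by blast
    qed
    moreover have "?Q w c (PathC n c w)"
    proof (intro allI impI)
      fix S assume "\<not> sem (PathC n c w) (Y(k := S)) {}"
      then have "\<not> ?P m (Y(k := S))" for m using PathC by blast
      then show "\<not> sem c (Y(k := S)) {} \<and> req A w (Y(k := S)) \<and> req (- A) w (Y(k := S))"
        unfolding req_def by blast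
    qed
    ultimately show ?thesis by blast
  qed
  \<comment> \<open>The conjunct about \<open>i = 0\<close> makes the sequence of classes start at
    the given \<open>c\<close>.\<close>
  have "\<exists>C. \<forall>i. (?ne (C i) \<and> (i = 0 \<longrightarrow> C i = c)) \<and> ?Q (from_nat i) (C i) (C (Suc i))"
  proof (rule dependent_nat_choice)
    show "\<exists>d. ?ne d \<and> (0 = (0::nat) \<longrightarrow> d = c)" using ne by blast
  next
    fix d and i :: nat assume "?ne d \<and> (i = 0 \<longrightarrow> d = c)"
    then show "\<exists>d'. (?ne d' \<and> (Suc i = 0 \<longrightarrow> d' = c)) \<and> ?Q (from_nat i) d d'"
      using step[of d "from_nat i"] by auto
  qed
  then obtain C where "\<forall>i. (?ne (C i) \<and> (i = 0 \<longrightarrow> C i = c)) \<and> ?Q (from_nat i) (C i) (C (Suc i))" ..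
  then have C: "\<And>i. ?ne (C i)" "C 0 = c" and Q: "\<And>i. ?Q (from_nat i) (C i) (C (Suc i))"
    by simp_all
  have decr: "\<not> sem (C i) (Y(k := S)) {}" if "i \<le> m" "\<not> sem (C m) (Y(k := S)) {}" for i m S
    using that by (induction rule: dec_induct) (use Q in blast)+
  \<comment> \<open>If no \<open>S\<close> were in all these decreasing closed classes, finitely
    many of their complements would cover everything, and the last class concerned would be
    empty.\<close>
  have "\<exists>S. \<forall>i. \<not> sem (C i) (Y(k := S)) {}"
  proof (rule ccontr)
    assume "\<not> ?thesis"
    then have all: "\<exists>i. sem (C i) (Y(k := S)) {}" for S by blast
    have "\<exists>m. interior (\<lambda>Y. \<forall>S. \<exists>i\<le>m. sem (C i) (Y(k := S)) {}) Y"
    proof (rule compact_env)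
      fix S
      from all[of S] obtain i where "sem (C i) (Y(k := S)) {}" ..
      from sem_interior[OF this] show "\<exists>m. interior (\<lambda>Y. \<exists>i\<le>m. sem (C i) Y {}) (Y(k := S))"
        by (intro exI[of _ i], elim interior_mono) blast
    qed (meson le_trans)
    then obtain m where "\<And>S. \<exists>i\<le>m. sem (C i) (Y(k := S)) {}" using interiorD by blast
    then show False using C(1)[of m] decr by blast
  qed
  then obtain S where S: "\<And>i. \<not> sem (C i) (Y(k := S)) {}" by blast
  have "good A (Y(k := S))"
    unfolding good_def
  proof
    fix w
    show "req A w (Y(k := S)) \<and> req (- A) w (Y(k := S))"
      using Q[of "to_nat w"] S[of "Suc (to_nat w)"] by simp
  qed
  moreover have "\<not> sem c (Y(k := S)) {}" using S[of 0] C(2) by simp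
  ultimately show ?thesis using that by blast
qed

section \<open>A generic stable linear order\<close>

definition linear :: "(nat \<Rightarrow> nat \<Rightarrow> bool) \<Rightarrow> bool" where
  "linear lt \<longleftrightarrow> (\<forall>x. \<not> lt x x) \<and> (\<forall>x y z. lt x y \<longrightarrow> lt y z \<longrightarrow> lt x z) \<and> (\<forall>x y. lt x y \<or> x = y \<or> lt y x)"

text \<open>The cut is left out on purpose: it is determined by the order only in the limit, and it
  has to be hyperimmune relative to the order.\<close>

definition order_env :: "(nat \<Rightarrow> nat \<Rightarrow> bool) \<Rightarrow> env" where
  "order_env lt = (\<lambda>_. {})(0 := {pr x y | x y. lt x y})"

text \<open>A forcing condition consists of an order on \<open>{..<n}\<close> together with a cut \<open>A \<inter> {..<n}\<close>; the
  infinite objects below matter only up to \<open>n\<close>. Elements from \<open>n\<close> on are inserted into the cut.\<close>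

definition ext :: "nat \<Rightarrow> (nat \<Rightarrow> nat \<Rightarrow> bool) \<Rightarrow> nat set \<Rightarrow> (nat \<Rightarrow> nat \<Rightarrow> bool) \<Rightarrow> nat set \<Rightarrow> bool" where
  "ext n lt A lt' A' \<longleftrightarrow> (\<forall>x<n. \<forall>y<n. lt' x y \<longleftrightarrow> lt x y) \<and> (\<forall>x<n. x \<in> A' \<longleftrightarrow> x \<in> A) \<and>
     (\<forall>x<n. \<forall>y\<ge>n. lt' x y \<longleftrightarrow> x \<in> A)"

lemma agree_order_env:
  assumes "\<And>x y. x < N \<Longrightarrow> y < N \<Longrightarrow> lt' x y \<longleftrightarrow> lt x y"
  shows "agree N (order_env lt) (order_env lt')"
proof -
  have "p \<in> {pr x y | x y. lt x y} \<longleftrightarrow> p \<in> {pr x y | x y. lt' x y}" if "p < N" for p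
  proof -
    have "lt' x y \<longleftrightarrow> lt x y" if "p = pr x y" for x y
      using assms[of x y] le_pr1[of x y] le_pr2[of y x] \<open>p < N\<close> that by simp
    then show ?thesis by blast
  qed
  then show ?thesis by (simp add: agree_def order_env_def)
qed

lemma ext_trans:
  assumes "ext n lt A lt' A'" "ext n' lt' A' lt'' A''" "n \<le> n'"
  shows "ext n lt A lt'' A''"
proof -
  have "lt'' x y \<longleftrightarrow> x \<in> A" if "x < n" "n \<le> y" for x y
  proof -
    have "x < n'" using that(1) assms(3) by simp
    then show ?thesis using assms(1,2) that unfolding ext_def by (cases "y < n'") auto
  qed
  then show ?thesis using assms unfolding ext_def by simp
qed

text \<open>All elements from \<open>n\<close> on lie between the part of \<open>A\<close> below
  \<open>n\<close> and the rest below \<open>n\<close>. So \<open>A\<close> below \<open>n\<close>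
  is an initial segment, and remains one when everything from \<open>n\<close> on is added. Hence
  all of \<open>{n..<N}\<close> can go to either side without changing the order below
  \<open>N\<close>.\<close>

lemma place_above_or_below:
  fixes b :: bool
  assumes lin: "linear lt" and cond: "ext n lt A lt A" and "n \<le> N"
  defines "A' \<equiv> {x. if x < n then x \<in> A else b}"
  defines "lt' \<equiv> \<lambda>x y. if x < N \<and> y < N then lt x y
      else if x < N then x \<in> A' else if y < N then y \<notin> A' else x < y"
  shows "linear lt'" "ext N lt' A' lt' A'" "ext n lt A lt' A'"
proof -
  have irr: "\<not> lt x x" and tr: "lt x y \<Longrightarrow> lt y z \<Longrightarrow> lt x z" and tot: "lt x y \<or> x = y \<or> lt y x" for x y z
    using lin unfolding linear_def by blast+
  have cut: "x < n \<Longrightarrow> n \<le> y \<Longrightarrow> lt x y \<longleftrightarrow> x \<in> A" for x y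
    using cond unfolding ext_def by blast
  have init: "lt x y" if "x \<in> A'" "y \<notin> A'" for x y
  proof (cases "x < n")
    case True
    then have x: "lt x n" using that cut[of x n] by (simp add: A'_def)
    show ?thesis
    proof (cases "y < n")
      case y: True
      then have "\<not> lt y n" "y \<noteq> n" using that cut[of y n] by (simp_all add: A'_def)
      then show ?thesis using x tot[of y n] tr[of x n y] by simp
    next
      case False
      then show ?thesis using True that cut[of x y] by (simp add: A'_def)
    qed
  next
    case False
    then have b using that(1) by (simp add: A'_def)
    then have "y < n" "y \<notin> A" using that(2) by (auto simp: A'_def split: if_splits)
    then show ?thesis using False cut[of y x] tot[of y x] by auto
  qed
  have asym: "x \<in> A'" if "lt x y" "y \<in> A'" for x y
    using init[of y x] that tr[of x y x] irr[of x] by metis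
  show "linear lt'"
    unfolding linear_def
  proof (intro conjI allI impI)
    show "\<not> lt' x x" for x using irr by (simp add: lt'_def)
    show "lt' x y \<or> x = y \<or> lt' y x" for x y using tot[of x y] by (auto simp: lt'_def)
    show "lt' x z" if "lt' x y" "lt' y z" for x y z
    proof -
      have "lt x y \<and> y \<in> A' \<longrightarrow> x \<in> A'" "lt y z \<and> z \<in> A' \<longrightarrow> y \<in> A'" "x \<in> A' \<and> z \<notin> A' \<longrightarrow> lt x z"
        "lt x y \<and> lt y z \<longrightarrow> lt x z" "x < y \<and> y < z \<longrightarrow> x < z"
        using asym[of x y] asym[of y z] init[of x z] tr[of x y z] less_trans[of x y z] by simp_all
      then show ?thesis using that unfolding lt'_def
        by (cases "x < N"; cases "y < N"; cases "z < N"; simp only: if_True if_False simp_thms; blast)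
    qed
  qed
  show "ext N lt' A' lt' A'" by (simp add: ext_def lt'_def)
  show "ext n lt A lt' A'"
    unfolding ext_def
  proof (intro conjI allI impI)
    show "lt' x y \<longleftrightarrow> lt x y" if "x < n" "y < n" for x y
      using that \<open>n \<le> N\<close> by (simp add: lt'_def)
    show "x \<in> A' \<longleftrightarrow> x \<in> A" if "x < n" for x using that by (simp add: A'_def)
    show "lt' x y \<longleftrightarrow> x \<in> A" if "x < n" "n \<le> y" for x y
      using that \<open>n \<le> N\<close> cut[of x y] by (cases "y < N") (simp_all add: lt'_def A'_def)
  qed
qed

text \<open>If some extension makes \<open>w\<close> enumerate a set beyond \<open>n\<close>, this
  used the order below some \<open>N\<close> only, and all of \<open>{n..<N}\<close> can still be
  sent to the side named by \<open>b\<close>. If none does, the premise of the requirement fails at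
  \<open>n\<close> in every further extension.\<close>

lemma generic_order_step:
  assumes lin: "linear lt" and cond: "ext n lt A lt A"
  shows "\<exists>n' lt' A'. n < n' \<and> linear lt' \<and> ext n' lt' A' lt' A' \<and> ext n lt A lt' A' \<and>
    (\<forall>lt'' A''. linear lt'' \<longrightarrow> ext n' lt' A' lt'' A'' \<longrightarrow>
      req (if b then A'' else - A'') w (order_env lt''))"
proof -
  define B where "B C = (if b then C else - C)" for C :: "nat set"
  show ?thesis
  proof (cases "\<exists>lt' m D. linear lt' \<and> ext n lt A lt' A \<and> D \<subseteq> {n..m} \<and> sem w (order_env lt') D")
    case True
    then obtain lt' m D where lt': "linear lt'" "ext n lt A lt' A"
      and D: "D \<subseteq> {n..m}" "sem w (order_env lt') D" by blast
    obtain K where K: "\<And>Y. agree K (order_env lt') Y \<Longrightarrow> sem w Y D"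
      using sem_interior[OF D(2)] unfolding interior_def by blast
    define N where "N = Suc (max n (max m K))"
    define A' where "A' = {x. if x < n then x \<in> A else b}"
    define lt2 where "lt2 = (\<lambda>x y. if x < N \<and> y < N then lt' x y
      else if x < N then x \<in> A' else if y < N then y \<notin> A' else x < y)"
    have "ext n lt' A lt' A" using lt'(2) by (simp add: ext_def)
    note place = place_above_or_below[OF lt'(1) this, of N b, folded A'_def, folded lt2_def]
    have "req (B A'') w (order_env lt'')" if "ext N lt2 A' lt'' A''" for lt'' A''
    proof -
      have "agree N (order_env lt') (order_env lt'')"
        by (rule agree_order_env) (use that in \<open>simp add: ext_def lt2_def\<close>)
      then have "sem w (order_env lt'') D" by (intro K) (rule agree_mono, auto simp: N_def)
      moreover have "D \<subseteq> B A''"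
      proof
        fix x assume "x \<in> D"
        then have "n \<le> x" "x \<le> m" using D(1) by auto
        then have "n \<le> x" "x < N" by (simp_all add: N_def)
        then show "x \<in> B A''" using that by (simp add: ext_def A'_def B_def)
      qed
      ultimately show ?thesis unfolding req_def by blast
    qed
    moreover have "ext n lt A lt2 A'"
      using lt'(2) place(3) by (rule ext_trans[of n lt A lt' A n]) (simp_all add: N_def)
    moreover have "n < N" "n \<le> N" by (simp_all add: N_def)
    ultimately show ?thesis using place unfolding B_def
      by (intro exI[of _ N] exI[of _ lt2] exI[of _ A']) blast
  next
    case False
    define N where "N = Suc n"
    define A' where "A' = {x. if x < n then x \<in> A else b}"
    define lt2 where "lt2 = (\<lambda>x y. if x < N \<and> y < N then lt x y
      else if x < N then x \<in> A' else if y < N then y \<notin> A' else x < y)"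
    note place = place_above_or_below[OF lin cond, of N b, folded A'_def, folded lt2_def]
    have N: "n < N" "n \<le> N" by (simp_all add: N_def)
    have "req (B A'') w (order_env lt'')" if "linear lt''" "ext N lt2 A' lt'' A''" for lt'' A''
    proof -
      have "ext n lt A lt'' A''" by (rule ext_trans[OF place(3)[OF N(2)] that(2) N(2)])
      \<comment> \<open>The case assumption speaks of extensions with the set \<open>A\<close>;
        \<open>ext n\<close> looks at the second set below \<open>n\<close> only, where
        \<open>A''\<close> and \<open>A\<close> agree.\<close>
      then have "ext n lt A lt'' A" by (simp add: ext_def)
      then show ?thesis using False that(1) unfolding req_def by blast
    qed
    then show ?thesis using place N unfolding B_def
      by (intro exI[of _ N] exI[of _ lt2] exI[of _ A']) blast
  qed
qed

lemma generic_order: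
  obtains lt A where "linear lt" "\<And>x. \<exists>n. \<forall>y\<ge>n. lt x y \<longleftrightarrow> x \<in> A" "good A (order_env lt)"
proof -
  let ?P = "\<lambda>(n, lt, A). linear lt \<and> ext n lt A lt A"
  let ?Q = "\<lambda>i (n, lt, A) (n', lt', A'). n < n' \<and> ext n lt A lt' A' \<and>
    (\<forall>lt'' A''. linear lt'' \<longrightarrow> ext n' lt' A' lt'' A'' \<longrightarrow>
      req (if snd i then A'' else - A'') (fst i) (order_env lt''))"
  have "\<exists>p. \<forall>i. ?P (p i) \<and> ?Q (from_nat i :: code \<times> bool) (p i) (p (Suc i))"
  proof (rule dependent_nat_choice)
    have "?P (0, (<), {})" by (auto simp: linear_def ext_def)
    then show "\<exists>p. ?P p" ..
  next
    fix p :: "nat \<times> (nat \<Rightarrow> nat \<Rightarrow> bool) \<times> nat set" and i :: nat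
    obtain n lt A where p: "p = (n, lt, A)" by (cases p)
    assume "?P p"
    then have "linear lt" "ext n lt A lt A" by (simp_all add: p)
    from generic_order_step[OF this, of "snd (from_nat i :: code \<times> bool)" "fst (from_nat i :: code \<times> bool)"]
    obtain n' lt' A' where "?P (n', lt', A') \<and> ?Q (from_nat i :: code \<times> bool) p (n', lt', A')"
      unfolding p by auto
    then show "\<exists>p'. ?P p' \<and> ?Q (from_nat i :: code \<times> bool) p p'" ..
  qed
  then obtain p where *: "\<forall>i. ?P (p i) \<and> ?Q (from_nat i :: code \<times> bool) (p i) (p (Suc i))" ..
  note p = conjunct1[OF spec[OF *]] conjunct2[OF spec[OF *]]
  define n lt A where "n i = fst (p i)" and "lt i = fst (snd (p i))" and "A i = snd (snd (p i))" for i
  have lin: "linear (lt i)" and n: "n i < n (Suc i)" and ext_Suc: "ext (n i) (lt i) (A i) (lt (Suc i)) (A (Suc i))"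
    and ext_refl: "ext (n i) (lt i) (A i) (lt i) (A i)" for i
    using p(1)[of i] p(2)[of i] by (simp_all add: n_def lt_def A_def case_prod_beta)
  have force: "req (if snd (from_nat i :: code \<times> bool) then A'' else - A'') (fst (from_nat i :: code \<times> bool)) (order_env lt'')"
    if "linear lt''" "ext (n (Suc i)) (lt (Suc i)) (A (Suc i)) lt'' A''" for i lt'' A''
    using p(2)[of i] that by (simp add: n_def lt_def A_def case_prod_beta)
  have n_mono: "n i \<le> n j" if "i \<le> j" for i j
    using that by (rule lift_Suc_mono_le[of n, OF less_imp_le[OF n]])
  have n_ge: "i \<le> n i" for i
  proof (induction i)
    case (Suc i)
    then show ?case using n[of i] by simp
  qed simp
  have ext: "ext (n i) (lt i) (A i) (lt j) (A j)" if "i \<le> j" for i j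
    using that
  proof (induction rule: dec_induct)
    case (step j)
    then show ?case using ext_trans ext_Suc n_mono by blast
  qed (rule ext_refl)
  \<comment> \<open>By \<open>n_ge\<close>, stage \<open>i\<close> has settled the order and the cut
    below \<open>i\<close>.\<close>
  define lt' where "lt' x y = lt (Suc (max x y)) x y" for x y
  define A' where "A' = {x. x \<in> A (Suc x)}"
  have lt'_eq: "lt' x y \<longleftrightarrow> lt i x y" if "x < i" "y < i" for x y i
    using ext[of "Suc (max x y)" i] that n_ge[of "Suc (max x y)"]
    by (simp add: ext_def lt'_def)
  have A'_eq: "x \<in> A' \<longleftrightarrow> x \<in> A i" if "x < n i" for x i
  proof (cases "Suc x \<le> i")
    case True
    then show ?thesis using ext[of "Suc x" i] n_ge[of "Suc x"] by (simp add: ext_def A'_def)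
  next
    case False
    then show ?thesis using ext[of i "Suc x"] that by (simp add: ext_def A'_def)
  qed
  have ext': "ext (n i) (lt i) (A i) lt' A'" for i
    unfolding ext_def
  proof (intro conjI allI impI)
    show "lt' x y \<longleftrightarrow> lt i x y" if "x < n i" "y < n i" for x y
    proof -
      let ?j = "max i (Suc (max x y))"
      have "lt' x y \<longleftrightarrow> lt ?j x y" by (rule lt'_eq) auto
      also have "\<dots> \<longleftrightarrow> lt i x y" using ext[of i ?j] that by (simp add: ext_def)
      finally show ?thesis .
    qed
    show "x \<in> A' \<longleftrightarrow> x \<in> A i" if "x < n i" for x using that by (rule A'_eq)
    show "lt' x y \<longleftrightarrow> x \<in> A i" if "x < n i" "n i \<le> y" for x y
    proof -
      let ?j = "max i (Suc (max x y))"
      have "lt' x y \<longleftrightarrow> lt ?j x y" by (rule lt'_eq) auto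
      also have "\<dots> \<longleftrightarrow> x \<in> A i" using ext[of i ?j] that by (simp add: ext_def)
      finally show ?thesis .
    qed
  qed
  have lin': "linear lt'"
    unfolding linear_def
  proof (intro conjI allI impI)
    fix x y z
    define i where "i = Suc (max x (max y z))"
    have eq: "lt' u v \<longleftrightarrow> lt i u v" if "u \<in> {x, y, z}" "v \<in> {x, y, z}" for u v
      by (rule lt'_eq) (use that in \<open>auto simp: i_def\<close>)
    show "\<not> lt' x x" using eq[of x x] lin[of i] by (simp add: linear_def)
    show "lt' x y \<or> x = y \<or> lt' y x" using eq[of x y] eq[of y x] lin[of i] by (simp add: linear_def)
    show "lt' x z" if "lt' x y" "lt' y z"
    proof -
      have "lt i x y" "lt i y z" using that eq[of x y] eq[of y z] by simp_all
      then have "lt i x z" using lin[of i] unfolding linear_def by blast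
      then show ?thesis using eq[of x z] by simp
    qed
  qed
  show ?thesis
  proof (rule that[OF lin'])
    fix x
    have "x < n (Suc x)" using n_ge[of "Suc x"] by simp
    then show "\<exists>m. \<forall>y\<ge>m. lt' x y \<longleftrightarrow> x \<in> A'"
      using ext'[of "Suc x"] unfolding ext_def by blast
  next
    have "req (if b then A' else - A') w (order_env lt')" for w b
      using force[OF lin' ext'[of "Suc (to_nat (w, b))"]] by simp
    from this[of True] this[of False] show "good A' (order_env lt')"
      by (simp add: good_def)
  qed
qed

section \<open>Continuity of the transformations\<close>

lemma locally_constD: "locally_const f Y \<Longrightarrow> interior (\<lambda>Y'. f Y' = f Y) Y"
  by (simp add: locally_const_def)

lemma locally_const_const: "locally_const (\<lambda>_. c) Y"
  by (simp add: locally_const_def interior_const)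

lemma locally_const_not: "locally_const P Y \<Longrightarrow> locally_const (\<lambda>Y. \<not> P Y) Y"
  by (rule locally_const_lift)

lemma locally_const_conj:
  "locally_const P Y \<Longrightarrow> locally_const Q Y \<Longrightarrow> locally_const (\<lambda>Y. P Y \<and> Q Y) Y"
  by (rule locally_const_lift2)

lemma locally_const_imp:
  "locally_const P Y \<Longrightarrow> locally_const Q Y \<Longrightarrow> locally_const (\<lambda>Y. P Y \<longrightarrow> Q Y) Y"
  by (rule locally_const_lift2)

lemma locally_const_Bex:
  assumes "finite E" "\<And>x. x \<in> E \<Longrightarrow> locally_const (P x) Y"
  shows "locally_const (\<lambda>Y. \<exists>x\<in>E. P x Y) Y"
proof -
  have "locally_const (\<lambda>Y. \<not> (\<forall>x\<in>E. \<not> P x Y)) Y"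
    by (intro locally_const_not locally_const_Ball assms)
  then show ?thesis by simp
qed

text \<open>A successful search inspects finitely many candidates; without a witness at
  \<open>Y\<close> there would be no such bound.\<close>

lemma locally_const_Least:
  assumes "\<And>v. locally_const (\<lambda>Y. P Y v) Y" and "P Y (v :: nat)"
  shows "locally_const (\<lambda>Y. LEAST v. P Y v) Y"
proof -
  define l where "l = (LEAST v. P Y v)"
  have l: "P Y l" "\<And>v. v < l \<Longrightarrow> \<not> P Y v"
    unfolding l_def by (rule LeastI, rule assms(2)) (rule not_less_Least)
  have "interior (\<lambda>Y'. \<forall>v\<in>{..l}. P Y' v = P Y v) Y"
    by (intro interior_Ball locally_constD assms(1)) simp
  then have "interior (\<lambda>Y'. (LEAST v. P Y' v) = l) Y"
  proof (rule interior_mono)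
    fix Y' assume eq: "\<forall>v\<in>{..l}. P Y' v = P Y v"
    show "(LEAST v. P Y' v) = l"
    proof (rule Least_equality)
      show "P Y' l" using eq l(1) by simp
      show "l \<le> v" if "P Y' v" for v
      proof (rule ccontr)
        assume "\<not> l \<le> v"
        then show False using eq l(2)[of v] that by simp
      qed
    qed
  qed
  then show ?thesis by (simp add: locally_const_def l_def)
qed

lemma locally_const_coded_fun:
  assumes "\<exists>v. pr (pr x 0) v \<in> Y j"
  shows "locally_const (\<lambda>Y. coded_fun (Y j) (Y i) x) Y"
proof -
  obtain v where "pr (pr x 0) v \<in> Y j" using assms ..
  then show ?thesis unfolding coded_fun_def
    by (intro locally_const_Least[where v = v] locally_const_lift2[of "\<lambda>Y. pr x _ \<in> Y i", where h = "\<lambda>a b. \<not> a \<or> b"] locally_const_mem) simp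
qed

lemma cont_at_Full: "cont_at (act (Put k Full)) Y"
  unfolding act.simps val.simps by (rule cont_at_upd) (simp add: locally_const_const)

lemma cont_at_Ones: "cont_at (act (Put k Ones)) Y"
  unfolding act.simps val.simps by (rule cont_at_upd) (rule locally_const_const)

lemma cont_at_Tail: "cont_at (act (Tail k m)) Y"
  unfolding act.simps val.simps
proof (rule cont_at_upd)
  fix x
  have "locally_const (\<lambda>Y. x \<in> Y k \<and> m \<le> x) Y"
    by (intro locally_const_conj locally_const_mem locally_const_const)
  then show "locally_const (\<lambda>Y. x \<in> Y k \<inter> {m..}) Y" by simp
qed

lemma cont_at_Stages: "cont_at (act (Put k Stages)) Y"
  unfolding act.simps val.simps
proof (rule cont_at_upd)
  fix p
  show "locally_const (\<lambda>Y. p \<in> {pr (pr x s) (if pr x s \<in> Y 0 then 1 else 0) | x s. True}) Y"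
  proof (cases "\<exists>x s u. p = pr (pr x s) u")
    case True
    then obtain x s u where p: "p = pr (pr x s) u" by blast
    have "locally_const (\<lambda>Y. u = (if pr x s \<in> Y 0 then 1 else 0)) Y"
      by (rule locally_const_lift[where h = "\<lambda>b. u = (if b then 1 else 0)"]) (rule locally_const_mem)
    then show ?thesis unfolding p by (auto elim!: back_subst[where P = "\<lambda>f. locally_const f Y"])
  next
    case False
    then have "p \<notin> {pr (pr x s) (if pr x s \<in> Y 0 then 1 else 0) | x s. True}" for Y :: env by blast
    then show ?thesis by (simp only: locally_const_const)
  qed
qed

lemma cont_at_Records:
  assumes "\<And>x. \<exists>v. pr (pr x 0) v \<in> Y j"
  shows "cont_at (act (Records j k)) Y"
  unfolding act.simps val.simps
proof (rule cont_at_upd2)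
  fix z
  have "locally_const (\<lambda>Y. z \<in> Y k \<and> (\<forall>y\<in>{..<z}. y \<in> Y k \<longrightarrow>
      coded_fun (Y j) (Y (Suc k)) y \<le> coded_fun (Y j) (Y (Suc k)) z)) Y"
    by (intro locally_const_conj locally_const_mem locally_const_Ball locally_const_imp
        locally_const_lift2[where h = "(\<le>)"] locally_const_coded_fun assms) simp
  moreover have "z \<in> {z \<in> Y k. \<forall>y\<in>Y k. y < z \<longrightarrow> coded_fun (Y j) (Y (Suc k)) y \<le> coded_fun (Y j) (Y (Suc k)) z} \<longleftrightarrow>
     z \<in> Y k \<and> (\<forall>y\<in>{..<z}. y \<in> Y k \<longrightarrow>
      coded_fun (Y j) (Y (Suc k)) y \<le> coded_fun (Y j) (Y (Suc k)) z)" for Y :: env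
    by blast
  ultimately show "locally_const (\<lambda>Y. z \<in> {z \<in> Y k. \<forall>y\<in>Y k. y < z \<longrightarrow>
      coded_fun (Y j) (Y (Suc k)) y \<le> coded_fun (Y j) (Y (Suc k)) z}) Y"
    by (simp only:)
qed

lemma cont_at_Level:
  assumes "\<And>x. \<exists>v. pr (pr x 0) v \<in> Y j"
  shows "cont_at (act (Level j k v)) Y"
  unfolding act.simps val.simps
proof (rule cont_at_upd2)
  fix z
  have "locally_const (\<lambda>Y. z \<in> Y k \<and> coded_fun (Y j) (Y (Suc k)) z = v) Y"
    by (intro locally_const_conj locally_const_mem
        locally_const_lift[where h = "\<lambda>u. u = v"] locally_const_coded_fun assms)
  then show "locally_const (\<lambda>Y. z \<in> {z \<in> Y k. coded_fun (Y j) (Y (Suc k)) z = v}) Y" by simp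
qed

text \<open>Some \<open>y \<ge> x\<close> becomes low and stays low by \<open>decr\<close>. From a
  stage \<open>t \<ge> y\<close> on, its presence blocks any later enumeration of \<open>x\<close>,
  so the search for a stage can stop at \<open>t\<close>.\<close>

lemma cont_at_Enum:
  assumes inf: "\<And>m. \<exists>y\<ge>m. \<exists>s. \<exists>u\<le>v. pr (pr y s) u \<in> Y j"
    and decr: "\<And>y s u. u \<le> v \<Longrightarrow> pr (pr y s) u \<in> Y j \<Longrightarrow> \<exists>u'\<le>v. pr (pr y (Suc s)) u' \<in> Y j"
  shows "cont_at (act (Put k (Enum j v b))) Y"
  unfolding act.simps val.simps
proof (rule cont_at_upd)
  fix x
  let ?low = "\<lambda>Y y s. \<exists>u\<le>v. pr (pr y s) u \<in> Y j"
  let ?en = "\<lambda>Y s. ?low Y x s \<and> (\<forall>s'<s. \<forall>y\<in>{x..s'}. \<forall>u\<le>v. pr (pr y s') u \<notin> Y j)"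
  obtain y s where y: "x \<le> y" "?low Y y s" using inf by blast
  define t where "t = s + y"
  have "?low Y y (s + d)" for d
    using y(2) decr by (induction d) auto
  then have t: "?low Y y t" "y \<le> t" by (simp_all add: t_def)
  have low: "locally_const (\<lambda>Y. ?low Y y s) Y" for y s
  proof -
    have "locally_const (\<lambda>Y. \<exists>u\<in>{..v}. pr (pr y s) u \<in> Y j) Y"
      by (intro locally_const_Bex locally_const_mem) simp
    then show ?thesis by (simp add: Bex_def)
  qed
  have en: "locally_const (\<lambda>Y. \<exists>s\<in>{x..t}. ?en Y s) Y"
  proof (intro locally_const_Bex)
    fix s
    have "locally_const (\<lambda>Y. ?low Y x s \<and> (\<forall>s'\<in>{..<s}. \<forall>y\<in>{x..s'}. \<not> ?low Y y s')) Y"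
      by (intro locally_const_conj locally_const_Ball locally_const_not low) simp_all
    then show "locally_const (\<lambda>Y. ?en Y s) Y" by (simp add: Ball_def)
  qed simp
  have "interior (\<lambda>Y'. ?low Y' y t) Y"
    using locally_constD[OF low[of y t]] by (rule interior_mono) (use t in simp)
  then have "interior (\<lambda>Y'. (\<exists>s\<ge>x. ?en Y' s) = (\<exists>s\<in>{x..t}. ?en Y' s)) Y"
  proof (rule interior_mono)
    fix Y' assume "?low Y' y t"
    then have le: "s \<le> t" if "?en Y' s" for s
      using that y(1) t(2) by (meson atLeastAtMost_iff not_le)
    show "(\<exists>s\<ge>x. ?en Y' s) = (\<exists>s\<in>{x..t}. ?en Y' s)"
    proof
      assume "\<exists>s\<ge>x. ?en Y' s"
      then obtain s where s: "x \<le> s" "?en Y' s" by blast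
      then have "s \<in> {x..t}" using le[OF s(2)] by simp
      then show "\<exists>s\<in>{x..t}. ?en Y' s" using s(2) by (rule bexI[rotated])
    next
      assume "\<exists>s\<in>{x..t}. ?en Y' s"
      then obtain s where s: "s \<in> {x..t}" "?en Y' s" by (rule bexE)
      then have "x \<le> s \<and> ?en Y' s" by simp
      then show "\<exists>s\<ge>x. ?en Y' s" by (rule exI)
    qed
  qed
  from locally_const_cong[OF en this]
  have "locally_const (\<lambda>Y. b \<le> x \<and> (\<exists>s\<ge>x. ?en Y s)) Y"
    by (intro locally_const_conj locally_const_const)
  then show "locally_const (\<lambda>Y. x \<in> {x. b \<le> x \<and> (\<exists>s\<ge>x. (\<exists>u\<le>v. pr (pr x s) u \<in> Y j) \<and>
      (\<forall>s'<s. \<forall>y\<in>{x..s'}. \<forall>u\<le>v. pr (pr y s') u \<notin> Y j))}) Y"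
    by simp
qed

lemma sat_bounded_locally_const:
  assumes "bounded_fm \<theta>" and E: "\<And>X. \<exists>i. \<forall>Y. E Y X = Y i"
  shows "locally_const (\<lambda>Y. sat M e (E Y) \<theta>) Y"
  using assms(1)
proof (induction \<theta> arbitrary: e)
  case (3 t X)
  obtain i where "\<And>Y. E Y X = Y i" using E by blast
  then show ?case by (simp add: locally_const_mem)
next
  case (6 \<phi> x t)
  have "tmval (e(x := a)) t = tmval e t" for a
    by (rule tmval_cong) (use 6 in auto)
  then have "sat M e (E Y) (AllN x (Imp (Less (Var x) t) \<phi>)) \<longleftrightarrow>
      (\<forall>a\<in>{..<tmval e t}. sat M (e(x := a)) (E Y) \<phi>)" for Y by auto
  then show ?case by (simp only:) (intro locally_const_Ball 6 finite_lessThan)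
next
  case (7 \<phi> x t)
  have "tmval (e(x := a)) t = tmval e t" for a
    by (rule tmval_cong) (use 7 in auto)
  then have "sat M e (E Y) (ExN x (Conj (Less (Var x) t) \<phi>)) \<longleftrightarrow>
      (\<exists>a\<in>{..<tmval e t}. sat M (e(x := a)) (E Y) \<phi>)" for Y by auto
  then show ?case by (simp only:) (intro locally_const_Bex 7 finite_lessThan)
qed (simp_all add: locally_const_const locally_const_not locally_const_imp)

lemma sat_bounded_indep:
  assumes "bounded_fm \<theta>"
  shows "sat M e E \<theta> \<longleftrightarrow> sat M' e E \<theta>"
  using assms by (induction \<theta> arbitrary: e) simp_all

text \<open>Running the \<open>\<Sigma>\<close>- and the \<open>\<Pi>\<close>-definition in parallel makes the use finite at every
  environment where they agree.\<close>

lemma cont_at_Compr: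
  assumes "bounded_fm \<theta>" "bounded_fm \<eta>"
    and "\<And>a. (\<exists>u. sat {} ((lookup es)(n := a, x := u)) (\<lambda>X. Y (lookup ls X)) \<theta>) \<longleftrightarrow>
      (\<forall>v. sat {} ((lookup es)(n := a, y := v)) (\<lambda>X. Y (lookup ls X)) \<eta>)"
  shows "cont_at (act (Put k (Compr n x \<theta> y \<eta> es ls))) Y"
  unfolding act.simps val.simps
proof (rule cont_at_upd)
  fix a
  define p where "p Y u = sat {} ((lookup es)(n := a, x := u)) (\<lambda>X. Y (lookup ls X)) \<theta>" for u and Y :: env
  define q where "q Y v = sat {} ((lookup es)(n := a, y := v)) (\<lambda>X. Y (lookup ls X)) \<eta>" for v and Y :: env
  have p: "locally_const (\<lambda>Y. p Y u) Y" and q: "locally_const (\<lambda>Y. q Y u) Y" for u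
    unfolding p_def q_def by (intro sat_bounded_locally_const assms; blast)+
  have eq: "(\<exists>u. p Y u) \<longleftrightarrow> (\<forall>v. q Y v)"
    using assms(3) by (simp add: p_def q_def)
  \<comment> \<open>The number \<open>w\<close> decides whether \<open>a\<close> belongs to the set.
    An accepting \<open>u\<close> beyond \<open>w\<close> would have passed the test
    \<open>q\<close> at \<open>w\<close>, hence \<open>p\<close> holds at \<open>w\<close>, and
    \<open>w\<close> accepts in its place.\<close>
  obtain w where w: "p Y w \<or> \<not> q Y w" using eq by blast
  have fin: "locally_const (\<lambda>Y. \<exists>u\<in>{..w}. p Y u \<and> (\<forall>v\<in>{..<u}. q Y v)) Y"
    by (intro locally_const_Bex locally_const_conj locally_const_Ball p q) simp_all
  have "interior (\<lambda>Y'. \<forall>u\<in>{..w}. p Y' u = p Y u \<and> q Y' u = q Y u) Y"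
    by (intro interior_Ball interior_conj locally_constD p q) simp
  then have "interior (\<lambda>Y'. (\<exists>u. p Y' u \<and> (\<forall>v<u. q Y' v)) = (\<exists>u\<in>{..w}. p Y' u \<and> (\<forall>v\<in>{..<u}. q Y' v))) Y"
  proof (rule interior_mono)
    fix Y' assume Y': "\<forall>u\<in>{..w}. p Y' u = p Y u \<and> q Y' u = q Y u"
    have bound: "\<exists>u\<le>w. p Y' u \<and> (\<forall>v<u. q Y' v)" if u: "p Y' u" "\<forall>v<u. q Y' v" for u
    proof (cases "u \<le> w")
      case False
      then have "q Y' w" using u by simp
      then have "p Y' w" using w Y' by auto
      then show ?thesis using u False by (intro exI[of _ w]) auto
    qed (use u in blast)
    show "(\<exists>u. p Y' u \<and> (\<forall>v<u. q Y' v)) = (\<exists>u\<in>{..w}. p Y' u \<and> (\<forall>v\<in>{..<u}. q Y' v))"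
      using bound by (auto simp: Ball_def Bex_def)
  qed
  from locally_const_cong[OF fin this]
  show "locally_const (\<lambda>Y. a \<in> {a. \<exists>u. sat {} ((lookup es)(n := a, x := u)) (\<lambda>X. Y (lookup ls X)) \<theta> \<and>
       (\<forall>v<u. sat {} ((lookup es)(n := a, y := v)) (\<lambda>X. Y (lookup ls X)) \<eta>)}) Y"
    by (simp add: p_def q_def)
qed

lemma val_Compr:
  assumes "\<And>a. (\<exists>u. sat {} ((lookup es)(n := a, x := u)) (\<lambda>X. Y (lookup ls X)) \<theta>) \<longleftrightarrow>
      (\<forall>v. sat {} ((lookup es)(n := a, y := v)) (\<lambda>X. Y (lookup ls X)) \<eta>)"
  shows "val (Compr n x \<theta> y \<eta> es ls) Y =
    {a. \<exists>u. sat {} ((lookup es)(n := a, x := u)) (\<lambda>X. Y (lookup ls X)) \<theta>}"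
  using assms by auto

section \<open>Limit non-decreasing subsequences that preserve hyperimmunity\<close>

lemma mono_on_Un:
  fixes f :: "nat \<Rightarrow> nat"
  assumes "mono_on F f" "mono_on E f" "\<And>x z. x \<in> F \<Longrightarrow> z \<in> E \<Longrightarrow> x < z \<and> f x \<le> f z"
  shows "mono_on (F \<union> E) f"
proof (rule mono_onI)
  fix x y assume xy: "x \<in> F \<union> E" "y \<in> F \<union> E" "x \<le> y"
  consider "x \<in> F" "y \<in> F" | "x \<in> F" "y \<in> E" | "x \<in> E" "y \<in> F" | "x \<in> E" "y \<in> E"
    using xy by blast
  then show "f x \<le> f y"
  proof cases
    case 1
    then show ?thesis using assms(1) xy(3) by (simp add: mono_onD)
  next
    case 2
    then show ?thesis using assms(3) by blast
  next
    case 3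
    then show ?thesis using assms(3)[of y x] xy(3) by simp
  next
    case 4
    then show ?thesis using assms(2) xy(3) by (simp add: mono_onD)
  qed
qed

text \<open>With the points strictly below the graph of \<open>f\<close> as the code, the search
  runs up to \<open>f x\<close>; the initial values cannot stop it earlier, being at least
  \<open>f x\<close>.\<close>

lemma coded_fun_restrict:
  assumes "pr (pr x 0) u \<in> H" "\<And>v. pr (pr x 0) v \<in> H \<Longrightarrow> f x \<le> v"
  shows "coded_fun H {pr y v | y v. v < f y} x = f x"
  unfolding coded_fun_def
proof (rule Least_equality)
  show "pr x (f x) \<notin> {pr y v | y v. v < f y} \<or> pr (pr x 0) (f x) \<in> H" by simp
  show "f x \<le> v" if "pr x v \<notin> {pr y v | y v. v < f y} \<or> pr (pr x 0) v \<in> H" for v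
    using that assms(2)[of v] by (auto simp: not_less)
qed

text \<open>\<open>f\<close> is the limit function, present in the environment only through its
  upper bounds in column \<open>j\<close>. The columns from \<open>k\<close> on are empty, which
  frees \<open>k\<close> for the reservoir and \<open>Suc k\<close> for a selector.\<close>

locale divergent_limit =
  fixes A :: "nat set" and Y :: env and j k :: nat and f :: "nat \<Rightarrow> nat"
  assumes good: "good A Y"
    and jk: "j < k"
    and empty: "\<And>i. k \<le> i \<Longrightarrow> Y i = {}"
    and total: "\<And>x. \<exists>v. pr (pr x 0) v \<in> Y j"
    and bound: "\<And>x v. pr (pr x 0) v \<in> Y j \<Longrightarrow> f x \<le> v"
    and diverges: "\<And>v. finite {x. f x \<le> v}"
begin

text \<open>Mathias conditions with stem \<open>F\<close> and reservoir \<open>Z\<close>.\<close>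

definition cond :: "nat set \<Rightarrow> nat set \<Rightarrow> bool" where
  "cond F Z \<longleftrightarrow> finite F \<and> infinite Z \<and> good A (Y(k := Z)) \<and> mono_on F f \<and>
     (\<forall>x\<in>F. \<forall>z\<in>Z. x < z \<and> f x \<le> f z)"

text \<open>By divergence, only finitely many points have a value at most some value of
  \<open>f\<close> on the new stem, and the reservoir is cut off behind them. The bound
  \<open>M\<close> lets the caller protect the use of a computation.\<close>

lemma cond_Un:
  assumes cond: "cond F Z" and E: "finite E" "E \<subseteq> Z" "mono_on E f"
  obtains m where "M \<le> m" "cond (F \<union> E) (Z \<inter> {m..})"
proof -
  have F: "finite F" "infinite Z" "good A (Y(k := Z))" "mono_on F f"
    and sep: "\<And>x z. x \<in> F \<Longrightarrow> z \<in> Z \<Longrightarrow> x < z \<and> f x \<le> f z"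
    using cond by (auto simp: cond_def)
  have fin: "finite (F \<union> E)" using F E by simp
  have "finite (\<Union>x\<in>F \<union> E. {y. f y \<le> f x} \<union> {..x})" using fin diverges by simp
  then obtain b where b: "\<And>x y. x \<in> F \<union> E \<Longrightarrow> f y \<le> f x \<or> y \<le> x \<Longrightarrow> y \<le> b"
    by (auto simp: finite_nat_set_iff_bounded_le)
  define m where "m = max M (Suc b)"
  have "infinite (Z \<inter> {m..})"
  proof
    assume "finite (Z \<inter> {m..})"
    then have "finite ((Z \<inter> {m..}) \<union> {..<m})" by simp
    moreover have "Z \<subseteq> (Z \<inter> {m..}) \<union> {..<m}" by auto
    ultimately have "finite Z" by (rule finite_subset[rotated])
    then show False using F(2) by simp
  qed
  moreover have "good A (Y(k := Z \<inter> {m..}))"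
    using good_act[OF F(3) cont_at_Tail, of k m] by simp
  moreover have "mono_on (F \<union> E) f"
    using F(4) E(3) by (rule mono_on_Un) (use sep E(2) in blast)
  moreover have "x < z \<and> f x \<le> f z" if "x \<in> F \<union> E" "z \<in> Z \<inter> {m..}" for x z
  proof -
    have "\<not> z \<le> b" using that by (simp add: m_def)
    then show ?thesis using b[OF that(1), of z] by linarith
  qed
  ultimately have "cond (F \<union> E) (Z \<inter> {m..})" using fin by (simp add: cond_def)
  then show ?thesis using that[of m] by (simp add: m_def)
qed

lemma cond_insert:
  assumes cond: "cond F Z"
  obtains z m where "z \<in> Z" "cond (F \<union> {z}) (Z \<inter> {m..})"
proof -
  have "infinite Z" using cond by (simp add: cond_def)
  then obtain z where z: "z \<in> Z" by (metis finite.emptyI ex_in_conv)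
  then have "finite {z}" "{z} \<subseteq> Z" "mono_on {z} f" by (simp_all add: mono_on_def)
  from cond_Un[OF cond this] obtain m where "cond (F \<union> {z}) (Z \<inter> {m..})" by metis
  with z show ?thesis by (rule that)
qed

text \<open>The first point of \<open>Z\<close> whose value exceeds all values of \<open>g\<close>
  on \<open>{..m}\<close> is a record beyond \<open>m\<close>; it exists because \<open>g\<close> is
  finite-to-one on \<open>Z\<close>.\<close>

lemma infinite_records:
  fixes g :: "nat \<Rightarrow> nat"
  assumes "infinite Z" "\<And>v. finite {z \<in> Z. g z = v}"
  shows "infinite {z \<in> Z. \<forall>y\<in>Z. y < z \<longrightarrow> g y \<le> g z}"
proof -
  have "\<exists>z\<ge>m. z \<in> Z \<and> (\<forall>y\<in>Z. y < z \<longrightarrow> g y \<le> g z)" for m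
  proof -
    define M where "M = Max (g ` {..m})"
    have M: "g y \<le> M" if "y \<le> m" for y
      using that by (simp add: M_def)
    have "finite (\<Union>v\<in>{..M}. {z \<in> Z. g z = v})" using assms(2) by simp
    then have "finite {z \<in> Z. g z \<le> M}" by (rule finite_subset[rotated]) auto
    then have "\<not> Z \<subseteq> {z \<in> Z. g z \<le> M}" using assms(1) finite_subset by blast
    then obtain z0 where "z0 \<in> Z" "\<not> g z0 \<le> M" by blast
    then have z0: "z0 \<in> Z \<and> M < g z0" by simp
    define z where "z = (LEAST z. z \<in> Z \<and> M < g z)"
    have z: "z \<in> Z \<and> M < g z"
      unfolding z_def by (rule LeastI) (rule z0)
    have least: "g y \<le> M" if "y \<in> Z" "y < z" for y
      using not_less_Least[of y "\<lambda>z. z \<in> Z \<and> M < g z"] that unfolding z_def[symmetric] by auto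
    have "m \<le> z" using M[of z] z by (meson leD nat_le_linear)
    moreover have "g y \<le> g z" if "y \<in> Z" "y < z" for y
      using least[OF that] z by simp
    ultimately show ?thesis using z by blast
  qed
  then show ?thesis unfolding infinite_nat_iff_unbounded_le by auto
qed

text \<open>Either some fibre of the coded function is infinite, or the records are. Both come from
  continuous transformations, so hyperimmunity is preserved.\<close>

lemma thin_reservoir:
  assumes "infinite Z" "good A (Y(k := Z, Suc k := S))"
  obtains Z' where "Z' \<subseteq> Z" "infinite Z'" "good A (Y(k := Z'))" "mono_on Z' (coded_fun (Y j) S)"
proof -
  let ?g = "coded_fun (Y j) S"
  let ?V = "Y(k := Z, Suc k := S)"
  have V: "\<exists>v. pr (pr x 0) v \<in> ?V j" for x using total jk by simp
  have upd: "?V(k := Z', Suc k := {}) = Y(k := Z')" for Z'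
    using empty[of "Suc k"] by (auto simp: fun_eq_iff)
  have eq: "?V j = Y j" "?V k = Z" "?V (Suc k) = S" using jk by simp_all
  show ?thesis
  proof (cases "\<exists>v. infinite {z \<in> Z. ?g z = v}")
    case True
    then obtain v where v: "infinite {z \<in> Z. ?g z = v}" ..
    have "act (Level j k v) ?V = Y(k := {z \<in> Z. ?g z = v})"
      unfolding act.simps eq upd ..
    then have "good A (Y(k := {z \<in> Z. ?g z = v}))"
      using good_act[OF assms(2) cont_at_Level[where Y = ?V and j = j, OF V], of k v] by simp
    moreover have "mono_on {z \<in> Z. ?g z = v} ?g" by (rule mono_onI) simp
    ultimately show ?thesis using v that[of "{z \<in> Z. ?g z = v}"] by auto
  next
    case False
    let ?R = "{z \<in> Z. \<forall>y\<in>Z. y < z \<longrightarrow> ?g y \<le> ?g z}"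
    have "act (Records j k) ?V = Y(k := ?R)"
      unfolding act.simps eq upd ..
    then have "good A (Y(k := ?R))"
      using good_act[OF assms(2) cont_at_Records[where Y = ?V and j = j, OF V], of k] by simp
    moreover have "infinite ?R" using assms(1) False by (intro infinite_records) auto
    moreover have "mono_on ?R ?g"
    proof (rule mono_onI)
      fix x y assume "x \<in> ?R" "y \<in> ?R" "x \<le> y"
      then show "?g x \<le> ?g y" by (cases "x = y") auto
    qed
    ultimately show ?thesis using that[of ?R] by auto
  qed
qed

text \<open>Whether some finite extension inside the reservoir forces the enumeration is asked for all
  functions below the bound at once, which makes the question open; a counterexample \<open>S\<close> can be
  chosen to preserve hyperimmunity, and thinning the reservoir to be nondecreasing for \<open>S\<close> as well
  then forces the negation.\<close>

lemma cond_req: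
  assumes cond: "cond F Z" and B: "B = A \<or> B = - A"
  obtains F' Z' where "cond F' Z'" "F \<subseteq> F'" "F' \<subseteq> F \<union> Z" "Z' \<subseteq> Z"
    "\<And>G. F' \<subseteq> G \<Longrightarrow> G \<subseteq> F' \<union> Z' \<Longrightarrow> req B w (Y(k := G))"
proof -
  have F: "finite F" "infinite Z" "good A (Y(k := Z))" "mono_on F f"
    and sep: "\<And>x z. x \<in> F \<Longrightarrow> z \<in> Z \<Longrightarrow> x < z \<and> f x \<le> f z"
    using cond by (auto simp: cond_def)
  obtain xs where xs: "set xs = F" using finite_list[OF F(1)] ..
  have upd: "(Y(k := U))(k := V, Suc k := {}) = Y(k := V)" for U V
    using empty[of "Suc k"] by (auto simp: fun_eq_iff)
  have eq: "(Y(k := U)) j = Y j" "(Y(k := U, Suc k := V)) j = Y j" for U V using jk by simp_all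
  show ?thesis
  proof (cases "\<forall>n. \<exists>m. \<exists>D\<subseteq>{n..m}. sem (StepU j k xs w) (Y(k := Z)) D")
    case True
    then obtain D where D: "D \<subseteq> B" "sem (StepU j k xs w) (Y(k := Z)) D"
      using goodD[OF F(3) _ B, of "StepU j k xs w"] by blast
    \<comment> \<open>The answer holds for every \<open>S\<close>, hence for the one coding the true
      limit, which may be arbitrarily complicated.\<close>
    define S where "S = {pr y v | y v. v < f y}"
    have S: "coded_fun (Y j) S = f"
    proof
      fix x
      obtain u where "pr (pr x 0) u \<in> Y j" using total by blast
      then show "coded_fun (Y j) S x = f x"
        unfolding S_def using bound by (rule coded_fun_restrict)
    qed
    obtain E D' where E: "finite E" "E \<subseteq> Z" "mono_on E f" and D': "D' \<subseteq> D" "sem w (Y(k := F \<union> E)) D'"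
      using interiorD[OF D(2)[unfolded sem.simps], THEN spec, of S]
      unfolding eq upd xs S fun_upd_same by blast
    obtain N where N: "\<And>Y'. agree N (Y(k := F \<union> E)) Y' \<Longrightarrow> sem w Y' D'"
      using sem_interior[OF D'(2)] unfolding interior_def by blast
    obtain m where m: "N \<le> m" "cond (F \<union> E) (Z \<inter> {m..})"
      using cond_Un[OF cond E] by blast
    have "req B w (Y(k := G))" if "F \<union> E \<subseteq> G" "G \<subseteq> F \<union> E \<union> (Z \<inter> {m..})" for G
    proof -
      have "x \<in> G \<longleftrightarrow> x \<in> F \<union> E" if "x < N" for x
        using \<open>F \<union> E \<subseteq> G\<close> \<open>G \<subseteq> F \<union> E \<union> (Z \<inter> {m..})\<close> that m(1) by auto
      then have "(F \<union> E) \<inter> {..<N} = G \<inter> {..<N}" by blast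
      then have "sem w (Y(k := G)) D'" by (intro N agree_upd agree_refl)
      then show ?thesis using D(1) D'(1) unfolding req_def by blast
    qed
    then show ?thesis using that[OF m(2)] E(2) by blast
  next
    case False
    then obtain n where n: "\<And>m D. D \<subseteq> {n..m} \<Longrightarrow> \<not> sem (StepU j k xs w) (Y(k := Z)) D" by blast
    let ?Yz = "Y(k := Z)"
    let ?c = "StepC j k xs n w"
    let ?P = "\<lambda>m Y. \<exists>E. finite E \<and> E \<subseteq> Y k \<and> mono_on E (coded_fun (Y j) (Y (Suc k))) \<and>
      (\<exists>D'\<subseteq>{n..m}. sem w (Y(k := set xs \<union> E, Suc k := {})) D')"
    \<comment> \<open>A witness \<open>E\<close> is finite, and the initial values bound the search
      in \<open>coded_fun\<close>, so the witness survives small changes of the environment.\<close>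
    have P_interior: "interior (?P m) (?Yz(Suc k := S))" if P: "?P m (?Yz(Suc k := S))" for m S
    proof -
      let ?V = "?Yz(Suc k := S)"
      obtain E D' where E: "finite E" "E \<subseteq> ?V k" "mono_on E (coded_fun (?V j) (?V (Suc k)))"
        and D': "D' \<subseteq> {n..m}" "sem w (?V(k := set xs \<union> E, Suc k := {})) D'"
        using P by blast
      have "interior (\<lambda>Y'. \<forall>x\<in>E. (x \<in> Y' k) = (x \<in> ?V k)) ?V"
        by (intro interior_Ball E(1) locally_constD locally_const_mem)
      moreover have "interior (\<lambda>Y'. \<forall>x\<in>E. coded_fun (Y' j) (Y' (Suc k)) x = coded_fun (?V j) (?V (Suc k)) x) ?V"
        by (intro interior_Ball E(1) locally_constD locally_const_coded_fun) (use total jk in simp)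
      moreover have "interior (\<lambda>Y'. sem w (Y'(k := set xs \<union> E, Suc k := {})) D') ?V"
        by (rule interior_comp[OF cont_at_upd2[OF locally_const_const] sem_interior[OF D'(2)]])
      ultimately have "interior (\<lambda>Y'. (\<forall>x\<in>E. (x \<in> Y' k) = (x \<in> ?V k)) \<and>
          (\<forall>x\<in>E. coded_fun (Y' j) (Y' (Suc k)) x = coded_fun (?V j) (?V (Suc k)) x) \<and>
          sem w (Y'(k := set xs \<union> E, Suc k := {})) D') ?V"
        by (intro interior_conj)
      then show ?thesis
      proof (rule interior_mono)
        fix Y' assume Y': "(\<forall>x\<in>E. (x \<in> Y' k) = (x \<in> ?V k)) \<and>
          (\<forall>x\<in>E. coded_fun (Y' j) (Y' (Suc k)) x = coded_fun (?V j) (?V (Suc k)) x) \<and>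
          sem w (Y'(k := set xs \<union> E, Suc k := {})) D'"
        have "E \<subseteq> Y' k" using Y' E(2) by blast
        moreover have "mono_on E (coded_fun (Y' j) (Y' (Suc k)))"
        proof (rule mono_onI)
          fix x y assume "x \<in> E" "y \<in> E" "x \<le> y"
          then show "coded_fun (Y' j) (Y' (Suc k)) x \<le> coded_fun (Y' j) (Y' (Suc k)) y"
            using mono_onD[OF E(3)] conjunct1[OF conjunct2[OF Y']] by metis
        qed
        ultimately show "?P m Y'" using E(1) D'(1) Y' by blast
      qed
    qed
    have sem_c: "sem ?c (?Yz(Suc k := S)) {}" if "?P m (?Yz(Suc k := S))" for m S
      unfolding sem.simps by (rule interior_mono[OF P_interior[OF that]]) blast
    \<comment> \<open>If every \<open>S\<close> had a witness \<open>E\<close>, compactness would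
      bound all enumerated sets by one \<open>m\<close>, and \<open>StepU\<close> would enumerate
      \<open>{n..m}\<close> after all.\<close>
    have "\<exists>S. \<not> sem ?c (?Yz(Suc k := S)) {}"
    proof (rule ccontr)
      assume "\<not> ?thesis"
      then have all: "sem ?c (?Yz(Suc k := S)) {}" for S by blast
      have "\<exists>m. interior (\<lambda>Y'. \<forall>S. ?P m (Y'(Suc k := S))) ?Yz"
      proof (rule compact_env)
        fix S
        have "\<exists>m. ?P m (?Yz(Suc k := S))"
          using interiorD[OF all[of S, unfolded sem.simps]] by blast
        then obtain m where "?P m (?Yz(Suc k := S))" ..
        then have "interior (?P m) (?Yz(Suc k := S))" by (rule P_interior)
        then show "\<exists>m. interior (?P m) (?Yz(Suc k := S))" ..
      next
        fix m m' :: nat and Y' assume "m \<le> m'" "?P m Y'"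
        moreover have "{n..m} \<subseteq> {n..m'}" using \<open>m \<le> m'\<close> by auto
        ultimately show "?P m' Y'" by (meson subset_trans)
      qed
      then obtain m where m: "interior (\<lambda>Y'. \<forall>S. ?P m (Y'(Suc k := S))) ?Yz" ..
      have "sem (StepU j k xs w) ?Yz {n..m}"
        unfolding sem.simps
      proof (rule interior_mono[OF m], rule allI)
        fix Y' S assume "\<forall>S. ?P m (Y'(Suc k := S))"
        then have "?P m (Y'(Suc k := S))" ..
        moreover have "(Y'(Suc k := S)) k = Y' k" "(Y'(Suc k := S)) j = Y' j" "(Y'(Suc k := S)) (Suc k) = S"
          "(Y'(Suc k := S))(k := U, Suc k := {}) = Y'(k := U, Suc k := {})" for U
          using jk by (auto simp: fun_eq_iff)
        ultimately show "\<exists>E. finite E \<and> E \<subseteq> Y' k \<and> mono_on E (coded_fun (Y' j) S) \<and>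
          (\<exists>D'\<subseteq>{n..m}. sem w (Y'(k := set xs \<union> E, Suc k := {})) D')"
          by (simp only:)
      qed
      then show False using n by blast
    qed
    then obtain S where S: "\<not> sem ?c (?Yz(Suc k := S)) {}" and goodS: "good A (?Yz(Suc k := S))"
      using good_path[OF F(3)] by metis
    obtain Z' where Z': "Z' \<subseteq> Z" "infinite Z'" "good A (Y(k := Z'))" "mono_on Z' (coded_fun (Y j) S)"
      using thin_reservoir[OF F(2) goodS] by blast
    have "cond F Z'" using F Z' sep by (auto simp: cond_def)
    moreover have "req B w (Y(k := G))" if G: "F \<subseteq> G" "G \<subseteq> F \<union> Z'" for G
    proof -
      have "\<not> sem w (Y(k := G)) D" if D: "D \<subseteq> {n..m}" for D m
      proof
        assume "sem w (Y(k := G)) D"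
        then obtain N where N: "\<And>Y'. agree N (Y(k := G)) Y' \<Longrightarrow> sem w Y' D"
          using sem_interior unfolding interior_def by blast
        \<comment> \<open>Only the part of \<open>G\<close> below the use counts. Outside the stem
          it is a finite subset of \<open>Z'\<close>, so it is nondecreasing for \<open>S\<close>,
          and by the choice of \<open>S\<close> it cannot make \<open>w\<close> enumerate anything
          beyond \<open>n\<close>.\<close>
        define E where "E = (G - F) \<inter> {..<N}"
        have E: "finite E" "E \<subseteq> Z'" using G(2) by (auto simp: E_def)
        have "G \<inter> {..<N} = (set xs \<union> E) \<inter> {..<N}" using G(1) by (auto simp: E_def xs)
        then have "sem w (Y(k := set xs \<union> E)) D" by (intro N agree_upd agree_refl)
        moreover have "?Yz(Suc k := S, k := set xs \<union> E, Suc k := {}) = Y(k := set xs \<union> E)"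
          using empty[of "Suc k"] by (auto simp: fun_eq_iff)
        moreover have "mono_on E (coded_fun (Y j) S)" using Z'(4) E(2) by (rule mono_on_subset)
        moreover have "(?Yz(Suc k := S)) k = Z" "(?Yz(Suc k := S)) (Suc k) = S" by simp_all
        ultimately have "?P m (?Yz(Suc k := S))"
          using E Z'(1) D eq(2)[of Z S] by (intro exI[of _ E]) auto
        then show False using sem_c S by blast
      qed
      then show ?thesis unfolding req_def by blast
    qed
    ultimately show ?thesis using that[of F Z'] Z'(1) by blast
  qed
qed

text \<open>Besides meeting a requirement, each step puts a new point into the stem, so that the
  union of the stems is infinite.\<close>

lemma cond_step:
  assumes "cond F Z" "B = A \<or> B = - A"
  shows "\<exists>F' Z'. cond F' Z' \<and> F \<subset> F' \<and> F' \<subseteq> F \<union> Z \<and> Z' \<subseteq> Z \<and>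
    (\<forall>G. F' \<subseteq> G \<longrightarrow> G \<subseteq> F' \<union> Z' \<longrightarrow> req B w (Y(k := G)))"
proof (rule cond_req[OF assms, of w])
  fix F1 Z1
  assume 1: "cond F1 Z1" "F \<subseteq> F1" "F1 \<subseteq> F \<union> Z" "Z1 \<subseteq> Z"
    and req: "\<And>G. F1 \<subseteq> G \<Longrightarrow> G \<subseteq> F1 \<union> Z1 \<Longrightarrow> req B w (Y(k := G))"
  show ?thesis
  proof (rule cond_insert[OF 1(1)])
    fix z m
    assume z: "z \<in> Z1" "cond (F1 \<union> {z}) (Z1 \<inter> {m..})"
    have "z \<notin> F1" using 1(1) z(1) by (auto simp: cond_def)
    then have "F \<subset> F1 \<union> {z}" "F1 \<union> {z} \<subseteq> F \<union> Z" "Z1 \<inter> {m..} \<subseteq> Z" using 1 z(1) by auto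
    moreover have "req B w (Y(k := G))" if "F1 \<union> {z} \<subseteq> G" "G \<subseteq> F1 \<union> {z} \<union> (Z1 \<inter> {m..})" for G
      by (rule req) (use that z(1) in auto)
    ultimately show ?thesis using z(2)
      by (intro exI[of _ "F1 \<union> {z}"] exI[of _ "Z1 \<inter> {m..}"]) simp
  qed
qed

lemma generic_subsequence:
  obtains G where "infinite G" "mono_on G f" "good A (Y(k := G))"
proof -
  let ?B = "\<lambda>i. if snd (from_nat i :: code \<times> bool) then A else - A"
  let ?Q = "\<lambda>i (F, Z) (F', Z'). F \<subset> F' \<and> F' \<subseteq> F \<union> Z \<and> Z' \<subseteq> Z \<and>
    (\<forall>G. F' \<subseteq> G \<longrightarrow> G \<subseteq> F' \<union> Z' \<longrightarrow> req (?B i) (fst (from_nat i :: code \<times> bool)) (Y(k := G)))"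
  have "\<exists>p. \<forall>i. case_prod cond (p i) \<and> ?Q i (p i) (p (Suc i))"
  proof (rule dependent_nat_choice)
    have "good A (Y(k := UNIV))" using good_act[OF good cont_at_Full, of k] by simp
    then have "cond {} UNIV" by (simp add: cond_def mono_on_def)
    then show "\<exists>p. case_prod cond p" by (intro exI[of _ "({}, UNIV)"]) simp
  next
    fix p i assume "case_prod cond p"
    then obtain F Z where p: "p = (F, Z)" and cond: "cond F Z" by (cases p) auto
    have "?B i = A \<or> ?B i = - A" by simp
    from cond_step[OF cond this, of "fst (from_nat i :: code \<times> bool)"] obtain F' Z'
      where "cond F' Z' \<and> ?Q i (F, Z) (F', Z')" by auto
    then show "\<exists>p'. case_prod cond p' \<and> ?Q i p p'"
      unfolding p by (intro exI[of _ "(F', Z')"]) simp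
  qed
  then obtain p where *: "\<forall>i. case_prod cond (p i) \<and> ?Q i (p i) (p (Suc i))" ..
  define F Z where "F i = fst (p i)" and "Z i = snd (p i)" for i
  have cond: "cond (F i) (Z i)" and psub: "F i \<subset> F (Suc i)"
    and sub: "F (Suc i) \<subseteq> F i \<union> Z i" "Z (Suc i) \<subseteq> Z i" for i
    using spec[OF *, of i] by (simp_all add: F_def Z_def case_prod_beta)
  have force: "req (?B i) (fst (from_nat i :: code \<times> bool)) (Y(k := G))"
    if "F (Suc i) \<subseteq> G" "G \<subseteq> F (Suc i) \<union> Z (Suc i)" for i G
    using spec[OF *, of i] that by (simp add: F_def Z_def case_prod_beta)
  define G where "G = (\<Union>i. F i)"
  have F_mono: "F i \<subseteq> F i'" if "i \<le> i'" for i i'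
    using that by (rule lift_Suc_mono_le[of F, rotated]) (use psub in blast)
  have FZ: "F i' \<union> Z i' \<subseteq> F i \<union> Z i" if "i \<le> i'" for i i'
    using that by (rule lift_Suc_antimono_le[of "\<lambda>i. F i \<union> Z i", rotated]) (use sub in blast)
  have "F i' \<subseteq> F i \<union> Z i" for i i'
    using F_mono[of i' i] FZ[of i i'] by (cases "i \<le> i'") auto
  then have G: "F i \<subseteq> G" "G \<subseteq> F i \<union> Z i" for i by (auto simp: G_def)
  have fin: "finite (F i)" for i using cond by (simp add: cond_def)
  have card: "i \<le> card (F i)" for i
  proof (induction i)
    case (Suc i)
    then show ?case using psubset_card_mono[OF fin psub, of i] by simp
  qed simp
  have "infinite G"
  proof
    assume "finite G"
    then have "card (F (Suc (card G))) \<le> card G" using G(1) by (intro card_mono)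
    then show False using card[of "Suc (card G)"] by simp
  qed
  moreover have "mono_on G f"
  proof (rule mono_onI)
    fix x y assume xy: "x \<in> G" "y \<in> G" "x \<le> y"
    then obtain a b where "x \<in> F a" "y \<in> F b" by (auto simp: G_def)
    then have "x \<in> F (max a b)" "y \<in> F (max a b)" using F_mono[of a "max a b"] F_mono[of b "max a b"] by auto
    moreover have "mono_on (F (max a b)) f" using cond by (simp add: cond_def)
    ultimately show "f x \<le> f y" using xy(3) by (simp add: mono_onD)
  qed
  moreover have "good A (Y(k := G))"
  proof -
    have "req (if b then A else - A) w (Y(k := G))" for w b
      using force[OF G, of "to_nat (w, b)"] by simp
    from this[of True] this[of False] show ?thesis by (simp add: good_def)
  qed
  ultimately show ?thesis using that by blast
qed

end

lemma limit_nondecreasing_subsequence: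
  assumes good: "good A Y" and jk: "j < k" and empty: "\<And>i. k \<le> i \<Longrightarrow> Y i = {}"
    and graph: "\<And>x s u. pr (pr x s) u \<in> Y j \<longleftrightarrow> u = f x s"
    and decr: "\<And>x s. f x (Suc s) \<le> f x s"
    and lim: "\<And>x. \<exists>s. \<forall>t\<ge>s. f x t = l x"
  obtains G where "infinite G" "mono_on G l" "good A (Y(k := G))"
proof -
  have f_le: "f x t \<le> f x s" if "s \<le> t" for x s t
    using that by (rule lift_Suc_antimono_le[of "f x", rotated]) (rule decr)
  have l_le: "l x \<le> f x s" for x s
  proof -
    obtain t where "\<forall>t'\<ge>t. f x t' = l x" using lim by blast
    then have "f x (max s t) = l x" by simp
    then show ?thesis using f_le[of s "max s t" x] by simp
  qed
  show ?thesis
  proof (cases "\<exists>v. infinite {x. l x \<le> v}")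
    case False
    interpret divergent_limit A Y j k l
    proof unfold_locales
      show "\<exists>v. pr (pr x 0) v \<in> Y j" for x by (simp add: graph)
      show "l x \<le> v" if "pr (pr x 0) v \<in> Y j" for x v using that l_le by (simp add: graph)
      show "finite {x. l x \<le> v}" for v using False by simp
    qed (fact good jk empty)+
    show ?thesis using generic_subsequence that by blast
  next
    case True
    \<comment> \<open>Only finitely many limits are below this least \<open>v\<close>, all at points
      below \<open>b\<close>. So one approximation at most \<open>v\<close> at a point from
      \<open>b\<close> on shows that the limit there is exactly \<open>v\<close>.\<close>
    define v where "v = (LEAST v. infinite {x. l x \<le> v})"
    have v: "infinite {x. l x \<le> v}" unfolding v_def using True by (rule LeastI_ex)
    have "finite {x. l x < v}"
    proof (cases v)
      case (Suc u)
      then have "\<not> infinite {x. l x \<le> u}"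
        using not_less_Least[of u "\<lambda>v. infinite {x. l x \<le> v}"] unfolding v_def[symmetric] by simp
      then show ?thesis using Suc by (simp add: less_Suc_eq_le)
    qed simp
    then obtain b where b: "\<And>x. l x < v \<Longrightarrow> x < b"
      unfolding finite_nat_set_iff_bounded by auto
    have low: "\<exists>y\<ge>m. \<exists>s\<ge>y. f y s \<le> v" for m
    proof -
      obtain y where y: "m \<le> y" "l y \<le> v" using v unfolding infinite_nat_iff_unbounded_le by auto
      obtain s where "\<forall>t\<ge>s. f y t = l y" using lim by blast
      then have "f y (max s y) \<le> v" using y(2) by simp
      then show ?thesis using y(1) by (meson max.cobounded2)
    qed
    let ?X = "act (Put k (Enum j v b)) Y k"
    have X: "x \<in> ?X \<longleftrightarrow> b \<le> x \<and> (\<exists>s\<ge>x. f x s \<le> v \<and> (\<forall>s'<s. \<forall>y\<in>{x..s'}. v < f y s'))" for x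
    proof -
      have "(\<forall>u\<le>v. u \<noteq> w) \<longleftrightarrow> v < w" for w by (auto simp: not_le[symmetric])
      then show ?thesis by (simp add: graph)
    qed
    have "\<exists>x\<ge>m. x \<in> ?X" for m
    proof -
      \<comment> \<open>At the first stage at which a point from \<open>max m b\<close> on is low,
        that point has no competitor at an earlier stage, so it is enumerated.\<close>
      let ?R = "\<lambda>s. \<exists>y\<in>{max m b..s}. f y s \<le> v"
      define s where "s = (LEAST s. ?R s)"
      obtain y0 s0 where "max m b \<le> y0" "y0 \<le> s0" "f y0 s0 \<le> v" using low[of "max m b"] by blast
      then have "\<exists>s. ?R s" by (intro exI[of _ s0] bexI[of _ y0]) auto
      then have "?R s" unfolding s_def by (rule LeastI_ex)
      then obtain y where y: "max m b \<le> y" "y \<le> s" "f y s \<le> v" by auto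
      have min: "\<not> ?R s'" if "s' < s" for s'
        using that not_less_Least[of s' ?R] unfolding s_def[symmetric] by blast
      have "v < f z s'" if "s' < s" "z \<in> {y..s'}" for s' z
      proof -
        have "z \<in> {max m b..s'}" using that(2) y(1) by simp
        then show ?thesis using min[OF that(1)] by (meson not_le)
      qed
      then have "y \<in> ?X" unfolding X using y by auto
      then show ?thesis using y(1) by auto
    qed
    then have "infinite ?X" unfolding infinite_nat_iff_unbounded_le by blast
    moreover have "l x = v" if x: "x \<in> ?X" for x
    proof -
      obtain s where "b \<le> x" "f x s \<le> v" using x unfolding X by blast
      then show ?thesis using b[of x] l_le[of x s] by linarith
    qed
    then have "mono_on ?X l" by (intro mono_onI) simp
    moreover have "good A (Y(k := ?X))"
    proof -
      have "cont_at (act (Put k (Enum j v b))) Y"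
      proof (rule cont_at_Enum)
        show "\<exists>y\<ge>m. \<exists>s. \<exists>u\<le>v. pr (pr y s) u \<in> Y j" for m
          using low[of m] by (auto simp: graph)
        show "\<exists>u'\<le>v. pr (pr y (Suc s)) u' \<in> Y j" if "u \<le> v" "pr (pr y s) u \<in> Y j" for y s u
          using that decr[of y s] by (auto simp: graph)
      qed
      from good_act[OF good this] show ?thesis by simp
    qed
    ultimately show ?thesis using that by blast
  qed
qed

section \<open>The model\<close>

text \<open>Hyperimmunity is maintained relative to finite joins of members of the model.\<close>

definition trunc :: "nat \<Rightarrow> env \<Rightarrow> env" where
  "trunc n Y i = (if i \<le> n then Y i else {})"

definition fun2 :: "nat set \<Rightarrow> nat \<Rightarrow> nat \<Rightarrow> nat" where
  "fun2 H x s = (THE u. pr (pr x s) u \<in> H)"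

definition limit :: "nat set \<Rightarrow> nat \<Rightarrow> nat" where
  "limit H x = (LEAST u. u \<in> range (fun2 H x))"

definition lns_instance :: "nat set \<Rightarrow> bool" where
  "lns_instance H \<longleftrightarrow> (\<forall>x s u. pr (pr x s) u \<in> H \<longleftrightarrow> u = fun2 H x s) \<and>
     (\<forall>x s. fun2 H x (Suc s) \<le> fun2 H x s)"

lemma limit_eventually:
  assumes "lns_instance H"
  shows "\<exists>s. \<forall>t\<ge>s. fun2 H x t = limit H x"
proof -
  have "limit H x \<in> range (fun2 H x)"
    unfolding limit_def by (rule LeastI[of _ "fun2 H x 0"]) simp
  then obtain s where s: "fun2 H x s = limit H x" by auto
  have "fun2 H x t = limit H x" if "s \<le> t" for t
  proof (rule antisym)
    have "fun2 H x t \<le> fun2 H x s"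
      using that by (rule lift_Suc_antimono_le[of "fun2 H x", rotated]) (use assms in \<open>simp add: lns_instance_def\<close>)
    then show "fun2 H x t \<le> limit H x" using s by simp
    show "limit H x \<le> fun2 H x t" unfolding limit_def by (rule Least_le) simp
  qed
  then show ?thesis by blast
qed

text \<open>A task that makes no sense at this point is answered by the empty column, which does not
  change the environment.\<close>

lemma model_step:
  fixes task :: "opr + nat"
  assumes empty: "\<forall>i>n. Y i = {}" and good: "good A Y"
  shows "\<exists>S. good A (Y(Suc n := S)) \<and>
    (\<forall>p. task = Inl p \<longrightarrow> cont_at (act (Put (Suc n) p)) Y \<longrightarrow> S = val p Y) \<and>
    (\<forall>j. task = Inr j \<longrightarrow> j \<le> n \<longrightarrow> lns_instance (Y j) \<longrightarrow> infinite S \<and> mono_on S (limit (Y j)))"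
proof (cases task)
  case (Inl p)
  show ?thesis
  proof (cases "cont_at (act (Put (Suc n) p)) Y")
    case True
    from good_act[OF good this] show ?thesis using Inl by auto
  next
    case False
    have "Y(Suc n := {}) = Y" using empty by (auto simp: fun_eq_iff)
    then show ?thesis using Inl False good by (intro exI[of _ "{}"]) simp
  qed
next
  case (Inr j)
  show ?thesis
  proof (cases "j \<le> n \<and> lns_instance (Y j)")
    case True
    then have inst: "lns_instance (Y j)" and j: "j < Suc n" by simp_all
    have e: "Y i = {}" if "Suc n \<le> i" for i using empty that by simp
    have graph: "pr (pr x s) u \<in> Y j \<longleftrightarrow> u = fun2 (Y j) x s"
      and decr: "fun2 (Y j) x (Suc s) \<le> fun2 (Y j) x s" for x s u
      using inst by (simp_all add: lns_instance_def)
    show ?thesis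
    proof (rule limit_nondecreasing_subsequence[OF good j e graph decr limit_eventually[OF inst]])
      fix G assume "infinite G" "mono_on G (limit (Y j))" "good A (Y(Suc n := G))"
      then show ?thesis using Inr by (intro exI[of _ G]) simp
    qed
  next
    case False
    have "Y(Suc n := {}) = Y" using empty by (auto simp: fun_eq_iff)
    then show ?thesis using Inr False good by (intro exI[of _ "{}"]) simp
  qed
qed

lemma closed_model:
  assumes good0: "good A Y0" and empty0: "\<forall>i>0. Y0 i = {}"
  obtains Y where "Y 0 = Y0 0" "\<And>n. good A (trunc n Y)"
    "\<And>p N. \<exists>n\<ge>N. cont_at (act (Put (Suc n) p)) (trunc n Y) \<longrightarrow> Y (Suc n) = val p (trunc n Y)"
    "\<And>j. lns_instance (Y j) \<Longrightarrow> \<exists>S\<in>range Y. infinite S \<and> mono_on S (limit (Y j))"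
proof -
  \<comment> \<open>The discarded second component makes every task recur infinitely often, hence
    also after the columns it refers to exist.\<close>
  define task where "task n = (from_nat (fst (prod_decode n)) :: opr + nat)" for n
  let ?P = "\<lambda>n Y. (\<forall>i>n. Y i = {}) \<and> good A Y \<and> Y 0 = Y0 0"
  let ?Q = "\<lambda>n Y Y'. (\<forall>i\<le>n. Y' i = Y i) \<and>
    (\<forall>p. task n = Inl p \<longrightarrow> cont_at (act (Put (Suc n) p)) Y \<longrightarrow> Y' (Suc n) = val p Y) \<and>
    (\<forall>j. task n = Inr j \<longrightarrow> j \<le> n \<longrightarrow> lns_instance (Y j) \<longrightarrow>
      infinite (Y' (Suc n)) \<and> mono_on (Y' (Suc n)) (limit (Y j)))"
  have "\<exists>W. \<forall>n. ?P n (W n) \<and> ?Q n (W n) (W (Suc n))"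
  proof (rule dependent_nat_choice)
    show "\<exists>Y. ?P 0 Y" using good0 empty0 by blast
  next
    fix Y and n :: nat assume P: "?P n Y"
    obtain S where S: "good A (Y(Suc n := S)) \<and>
      (\<forall>p. task n = Inl p \<longrightarrow> cont_at (act (Put (Suc n) p)) Y \<longrightarrow> S = val p Y) \<and>
      (\<forall>j. task n = Inr j \<longrightarrow> j \<le> n \<longrightarrow> lns_instance (Y j) \<longrightarrow> infinite S \<and> mono_on S (limit (Y j)))"
      using model_step[of n Y A "task n"] P by auto
    have "?P (Suc n) (Y(Suc n := S)) \<and> ?Q n Y (Y(Suc n := S))"
      using P S by simp
    then show "\<exists>Y'. ?P (Suc n) Y' \<and> ?Q n Y Y'" by (rule exI[of _ "Y(Suc n := S)"])
  qed
  then obtain W where *: "\<forall>n. ?P n (W n) \<and> ?Q n (W n) (W (Suc n))" by (rule exE)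
  note P = conjunct1[OF spec[OF *]] and Q = conjunct2[OF spec[OF *]]
  define Y where "Y i = W i i" for i
  have W_empty: "W n i = {}" if "n < i" for n i
    using conjunct1[OF P, of n] that by blast
  have W_Suc: "W (Suc n) i = W n i" if "i \<le> n" for n i
    using conjunct1[OF Q, of n] that by blast
  have W_Y: "W n i = Y i" if "i \<le> n" for n i
    using that by (induction rule: dec_induct) (simp_all add: Y_def W_Suc)
  have W: "W n = trunc n Y" for n
    using W_Y W_empty by (auto simp: trunc_def fun_eq_iff)
  have task: "\<exists>n\<ge>N. task n = t" for t N
  proof -
    have "task (prod_encode (to_nat t, N)) = t" by (simp add: task_def)
    then show ?thesis using le_prod_encode_2 by blast
  qed
  show ?thesis
  proof (rule that)
    show "Y 0 = Y0 0" using P[of 0] unfolding Y_def by blast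
    show "good A (trunc n Y)" for n using P[of n] unfolding W by blast
    show "\<exists>n\<ge>N. cont_at (act (Put (Suc n) p)) (trunc n Y) \<longrightarrow> Y (Suc n) = val p (trunc n Y)" for p N
    proof -
      obtain n where n: "N \<le> n" "task n = Inl p" using task[of N "Inl p"] by blast
      then have "cont_at (act (Put (Suc n) p)) (trunc n Y) \<longrightarrow> Y (Suc n) = val p (trunc n Y)"
        using conjunct1[OF conjunct2[OF Q], of n] W_Y[of "Suc n" "Suc n"] unfolding W by simp
      then show ?thesis using n(1) by blast
    qed
    show "\<exists>S\<in>range Y. infinite S \<and> mono_on S (limit (Y j))" if "lns_instance (Y j)" for j
    proof -
      obtain n where n: "j \<le> n" "task n = Inr j" using task[of j "Inr j"] by blast
      then have "infinite (Y (Suc n)) \<and> mono_on (Y (Suc n)) (limit (Y j))"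
        using conjunct2[OF conjunct2[OF Q], of n] W_Y[of "Suc n" "Suc n"] W_Y[of j n] that by simp
      then show ?thesis by blast
    qed
  qed
qed

section \<open>Closure of the model under comprehension\<close>

lemma finite_vars_tm: "finite (vars_tm t)"
  by (induction t) auto

lemma finite_freeN: "finite (freeN \<phi>)"
  by (induction \<phi>) (auto simp: finite_vars_tm)

lemma finite_freeS: "finite (freeS \<phi>)"
  by (induction \<phi>) auto

lemma lookup_map: "x \<in> set xs \<Longrightarrow> lookup (map (\<lambda>x. (x, g x)) xs) x = g x"
  by (simp add: lookup_def map_of_map_restrict)

text \<open>A formula has finitely many parameters, so their values fit into the lists of a
  countable code, and at a late enough stage truncation keeps all the columns involved.\<close>

lemma valid_Delta01_comprehension:
  assumes closed: "\<And>p N. \<exists>n\<ge>N. cont_at (act (Put (Suc n) p)) (trunc n Y) \<longrightarrow> Y (Suc n) = val p (trunc n Y)"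
    and "\<gamma> \<in> Delta01_comprehension"
  shows "valid (range Y) \<gamma>"
  unfolding valid_def
proof (intro allI impI)
  fix e :: "string \<Rightarrow> nat" and E :: "string \<Rightarrow> nat set"
  assume E: "range E \<subseteq> range Y"
  let ?M = "range Y"
  obtain n X \<theta> \<eta> x y where \<gamma>: "\<gamma> = Imp (AllN n (Iff (ExN x \<theta>) (AllN y \<eta>)))
      (ExS X (AllN n (Iff (Mem (Var n) X) (ExN x \<theta>))))"
    and bounded: "bounded_fm \<theta>" "bounded_fm \<eta>" and X: "X \<notin> freeS (ExN x \<theta>)"
    using assms(2) by (auto simp: Delta01_comprehension_def Sigma01_def Pi01_def)
  have "\<forall>V. \<exists>i. E V = Y i" using E by blast
  then obtain ix where ix: "\<And>V. E V = Y (ix V)" by metis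
  obtain vs where vs: "set vs = freeN \<theta> \<union> freeN \<eta>" using finite_list finite_freeN finite_UnI by metis
  obtain Vs where Vs: "set Vs = freeS \<theta> \<union> freeS \<eta>" using finite_list finite_freeS finite_UnI by metis
  define es where "es = map (\<lambda>v. (v, e v)) vs"
  define ls where "ls = map (\<lambda>V. (V, ix V)) Vs"
  define p where "p = Compr n x \<theta> y \<eta> es ls"
  obtain N where N: "\<And>V. V \<in> set Vs \<Longrightarrow> ix V \<le> N"
    using finite_nat_set_iff_bounded_le[of "ix ` set Vs"] by auto
  obtain m where m: "N \<le> m" "cont_at (act (Put (Suc m) p)) (trunc m Y) \<longrightarrow> Y (Suc m) = val p (trunc m Y)"
    using closed by blast
  let ?E = "\<lambda>V. trunc m Y (lookup ls V)"
  have es: "lookup es v = e v" if "v \<in> freeN \<theta> \<union> freeN \<eta>" for v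
    using that vs by (simp add: es_def lookup_map)
  have ls: "?E V = E V" if "V \<in> freeS \<theta> \<union> freeS \<eta>" for V
  proof -
    have "lookup ls V = ix V" using that Vs by (simp add: ls_def lookup_map)
    moreover have "ix V \<le> m" using N[of V] that Vs m(1) by simp
    ultimately show ?thesis by (simp add: trunc_def ix)
  qed
  have \<theta>: "sat ?M (e(n := a, x := u)) E \<theta> \<longleftrightarrow> sat {} ((lookup es)(n := a, x := u)) ?E \<theta>" for a u
  proof -
    have "sat ?M (e(n := a, x := u)) E \<theta> \<longleftrightarrow> sat ?M ((lookup es)(n := a, x := u)) ?E \<theta>"
      by (rule sat_cong) (simp_all add: es ls)
    then show ?thesis using sat_bounded_indep[OF bounded(1)] by blast
  qed
  have \<eta>: "sat ?M (e(n := a, y := u)) E \<eta> \<longleftrightarrow> sat {} ((lookup es)(n := a, y := u)) ?E \<eta>" for a u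
  proof -
    have "sat ?M (e(n := a, y := u)) E \<eta> \<longleftrightarrow> sat ?M ((lookup es)(n := a, y := u)) ?E \<eta>"
      by (rule sat_cong) (simp_all add: es ls)
    then show ?thesis using sat_bounded_indep[OF bounded(2)] by blast
  qed
  show "sat ?M e E \<gamma>"
  proof (cases "\<forall>a. (\<exists>u. sat ?M (e(n := a, x := u)) E \<theta>) \<longleftrightarrow> (\<forall>v. sat ?M (e(n := a, y := v)) E \<eta>)")
    case True
    then have eq: "(\<exists>u. sat {} ((lookup es)(n := a, x := u)) ?E \<theta>) \<longleftrightarrow>
        (\<forall>v. sat {} ((lookup es)(n := a, y := v)) ?E \<eta>)" for a
      by (simp add: \<theta> \<eta>)
    have "Y (Suc m) = val p (trunc m Y)"
      using m(2) cont_at_Compr[OF bounded eq] unfolding p_def by blast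
    also have "\<dots> = {a. \<exists>u. sat ?M (e(n := a, x := u)) E \<theta>}"
      unfolding p_def val_Compr[OF eq] \<theta> ..
    finally have S: "a \<in> Y (Suc m) \<longleftrightarrow> sat ?M (e(n := a)) E (ExN x \<theta>)" for a
      by simp
    have indep: "sat ?M (e(n := a)) (E(X := Y (Suc m))) (ExN x \<theta>) \<longleftrightarrow> sat ?M (e(n := a)) E (ExN x \<theta>)" for a
      by (rule sat_cong) (use X in auto)
    have "sat ?M e (E(X := Y (Suc m))) (AllN n (Iff (Mem (Var n) X) (ExN x \<theta>)))"
      using S indep by simp
    then have "sat ?M e E (ExS X (AllN n (Iff (Mem (Var n) X) (ExN x \<theta>))))"
      by (subst sat.simps, subst sat.simps, subst sat.simps) blast
    then show ?thesis unfolding \<gamma> by (subst sat.simps) blast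
  next
    case False
    then have "\<not> sat ?M e E (AllN n (Iff (ExN x \<theta>) (AllN y \<eta>)))" by simp blast
    then show ?thesis unfolding \<gamma> by (subst sat.simps) blast
  qed
qed

section \<open>The principles read in an omega-model\<close>

lemma tmval_Pr [simp]: "tmval e (Pr s t) = pr (tmval e s) (tmval e t)"
  by (simp add: Pr_def pr_def)

lemma sat_Infinite: "sat M e E (Infinite X) \<longleftrightarrow> infinite (E X)"
  by (simp add: Infinite_def Let_def infinite_nat_iff_unbounded)

lemma sat_Fun1: "sat M e E (Fun1 F) \<longleftrightarrow> (\<forall>n\<in>E F. \<exists>x y. n = pr x y) \<and>
    (\<forall>x. \<exists>y. pr x y \<in> E F \<and> (\<forall>z. pr x z \<in> E F \<longrightarrow> z = y))"
  by (auto simp: Fun1_def Ap1_def Let_def)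

definition is_fun2 :: "nat set \<Rightarrow> bool" where
  "is_fun2 H \<longleftrightarrow> (\<forall>n\<in>H. \<exists>x s y. n = pr (pr x s) y) \<and>
    (\<forall>x s. \<exists>y. pr (pr x s) y \<in> H \<and> (\<forall>z. pr (pr x s) z \<in> H \<longrightarrow> z = y))"

lemma sat_Fun2: "sat M e E (Fun2 F) \<longleftrightarrow> is_fun2 (E F)"
  by (auto simp: Fun2_def Ap2_def Let_def is_fun2_def)

lemma sat_Lim:
  assumes "{''_s'', ''_t''} \<inter> (vars_tm x \<union> vars_tm y) = {}"
  shows "sat M e E (Defs.Lim F x y) \<longleftrightarrow> (\<exists>s. \<forall>t\<ge>s. pr (pr (tmval e x) t) (tmval e y) \<in> E F)"
proof -
  have "tmval (e(''_s'' := s, ''_t'' := t)) x = tmval e x" "tmval (e(''_s'' := s, ''_t'' := t)) y = tmval e y" for s t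
    by (rule tmval_cong; use assms in auto)+
  moreover have "(\<not> s < t \<longrightarrow> s = t) \<longleftrightarrow> s \<le> t" for s t :: nat by auto
  ultimately show ?thesis by (simp add: Defs.Lim_def Ap2_def Let_def)
qed

definition nondecreasing_on :: "nat set \<Rightarrow> nat set \<Rightarrow> bool" where
  "nondecreasing_on H S \<longleftrightarrow> (\<forall>x\<in>S. \<forall>y\<in>S. x < y \<longrightarrow>
    (\<exists>u v. (\<exists>s. \<forall>t\<ge>s. pr (pr x t) u \<in> H) \<and> (\<exists>s. \<forall>t\<ge>s. pr (pr y t) v \<in> H) \<and> u \<le> v))"

lemma sat_LimNonDecreasingOn: "sat M e E (LimNonDecreasingOn F X) \<longleftrightarrow> nondecreasing_on (E F) (E X)"
  by (auto simp: LimNonDecreasingOn_def Let_def sat_Lim le_less nondecreasing_on_def)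

lemma valid_LNS:
  assumes closed: "\<And>H. H \<in> M \<Longrightarrow> lns_instance H \<Longrightarrow> \<exists>S\<in>M. infinite S \<and> mono_on S (limit H)"
  shows "valid M LNS"
proof -
  have solution: "\<exists>S\<in>M. infinite S \<and> nondecreasing_on H S"
    if "H \<in> M" and total: "is_fun2 H"
      and decr: "\<And>x s y z. pr (pr x (Suc s)) y \<in> H \<Longrightarrow> pr (pr x s) z \<in> H \<Longrightarrow> y \<le> z" for H
  proof -
    have graph: "pr (pr x s) u \<in> H \<longleftrightarrow> u = fun2 H x s" for x s u
    proof -
      have "\<exists>!u. pr (pr x s) u \<in> H" using total unfolding is_fun2_def by metis
      from theI'[OF this] this show ?thesis unfolding fun2_def by blast
    qed
    then have inst: "lns_instance H" using decr by (simp add: lns_instance_def)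
    have lim: "\<exists>s. \<forall>t\<ge>s. pr (pr x t) (limit H x) \<in> H" for x
      using limit_eventually[OF inst, of x] unfolding graph by metis
    obtain S where S: "S \<in> M" "infinite S" "mono_on S (limit H)" using closed[OF \<open>H \<in> M\<close> inst] by blast
    have "nondecreasing_on H S"
      unfolding nondecreasing_on_def
    proof (intro ballI impI)
      fix x y assume xy: "x \<in> S" "y \<in> S" "x < y"
      then have "limit H x \<le> limit H y" using mono_onD[OF S(3) xy(1,2)] by simp
      then show "\<exists>u v. (\<exists>s. \<forall>t\<ge>s. pr (pr x t) u \<in> H) \<and> (\<exists>s. \<forall>t\<ge>s. pr (pr y t) v \<in> H) \<and> u \<le> v"
        using lim[of x] lim[of y] by blast
    qed
    then show ?thesis using S by blast
  qed
  have "sat M e E LNS \<longleftrightarrow> (\<forall>H\<in>M. is_fun2 H \<and>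
      (\<forall>x s y. pr (pr x (Suc s)) y \<in> H \<longrightarrow> (\<forall>z. pr (pr x s) z \<in> H \<longrightarrow> y \<le> z)) \<longrightarrow>
      (\<exists>S\<in>M. infinite S \<and> nondecreasing_on H S))" for e E
  proof -
    have "(\<not> y < z \<longrightarrow> y = z) \<longleftrightarrow> y \<le> z" for y z :: nat by auto
    then show ?thesis
      by (simp add: LNS_def Let_def sat_Fun2 sat_Infinite sat_LimNonDecreasingOn Ap2_def)
  qed
  then show ?thesis unfolding valid_def using solution by simp
qed

section \<open>The order and its colouring have no solutions in the model\<close>

text \<open>Arrays of singletons are the case in which hyperimmunity reduces to immunity.\<close>

lemma good_splits:
  assumes "good A Y" "\<And>n. \<exists>x\<ge>n. sem w Y {x}"
  shows "(\<exists>D\<subseteq>A. sem w Y D) \<and> (\<exists>D\<subseteq>- A. sem w Y D)"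
proof -
  have "\<exists>m. \<exists>D\<subseteq>{n..m}. sem w Y D" for n
  proof -
    obtain x where "n \<le> x" "sem w Y {x}" using assms(2) by blast
    then show ?thesis by (intro exI[of _ x] exI[of _ "{x}"]) simp
  qed
  then show ?thesis using assms(1) by (simp add: good_def req_def)
qed

lemma sem_Elem: "sem (Elem j n) Y D \<longleftrightarrow> (\<exists>x\<ge>n. D = {x} \<and> x \<in> Y j)"
proof
  assume "\<exists>x\<ge>n. D = {x} \<and> x \<in> Y j"
  then obtain x where x: "n \<le> x" "D = {x}" "x \<in> Y j" by blast
  show "sem (Elem j n) Y D"
    unfolding sem.simps
    by (rule interior_mono[OF locally_constD[OF locally_const_mem[of x j Y]]]) (use x in blast)
qed (simp, drule interiorD, assumption)

lemma sem_Val: "sem (Val j) Y D \<longleftrightarrow> (\<exists>i x. D = {x} \<and> pr i x \<in> Y j)"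
proof
  assume "\<exists>i x. D = {x} \<and> pr i x \<in> Y j"
  then obtain i x where x: "D = {x}" "pr i x \<in> Y j" by blast
  show "sem (Val j) Y D"
    unfolding sem.simps
    by (rule interior_mono[OF locally_constD[OF locally_const_mem[of "pr i x" j Y]]]) (use x in blast)
qed (simp, drule interiorD, assumption)

text \<open>The lower bound \<open>n\<close> is what lets a point outside \<open>A\<close> be found
  after a given point of \<open>A\<close>, contradicting monotonicity of the characteristic
  function.\<close>

lemma infinite_column_splits:
  assumes "good A (trunc j Y)" "infinite (Y j)"
  shows "\<exists>x\<ge>n. x \<in> Y j \<and> x \<in> A" "\<exists>x\<ge>n. x \<in> Y j \<and> x \<notin> A"
proof -
  have "\<exists>x\<ge>m. sem (Elem j n) (trunc j Y) {x}" for m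
  proof -
    obtain x where "max m n \<le> x" "x \<in> Y j"
      using assms(2) unfolding infinite_nat_iff_unbounded_le by blast
    then show ?thesis by (intro exI[of _ x]) (simp add: sem_Elem trunc_def del: sem.simps)
  qed
  from good_splits[OF assms(1) this]
  show "\<exists>x\<ge>n. x \<in> Y j \<and> x \<in> A" "\<exists>x\<ge>n. x \<in> Y j \<and> x \<notin> A"
    by (auto simp: sem_Elem trunc_def simp del: sem.simps)
qed

text \<open>The range of a sequence is merely enumerable from its column, so \<open>Val\<close> is
  used instead of looking for a column equal to it.\<close>

lemma infinite_range_splits:
  assumes "good A (trunc j Y)" "\<And>i. pr i (\<alpha> i) \<in> Y j" "\<And>i x. pr i x \<in> Y j \<Longrightarrow> x = \<alpha> i" "inj \<alpha>"
  shows "\<exists>i. \<alpha> i \<in> A" "\<exists>i. \<alpha> i \<notin> A"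
proof -
  have "\<exists>x\<ge>m. sem (Val j) (trunc j Y) {x}" for m
  proof -
    have "infinite (range \<alpha>)" using assms(4) by (simp add: finite_image_iff)
    then obtain i where "m \<le> \<alpha> i" unfolding infinite_nat_iff_unbounded_le by blast
    then show ?thesis using assms(2)[of i] by (intro exI[of _ "\<alpha> i"]) (auto simp: sem_Val trunc_def simp del: sem.simps)
  qed
  from good_splits[OF assms(1) this] obtain i x i' x'
    where "x \<in> A" "pr i x \<in> Y j" "x' \<notin> A" "pr i' x' \<in> Y j"
    by (auto simp: sem_Val trunc_def simp del: sem.simps)
  then show "\<exists>i. \<alpha> i \<in> A" "\<exists>i. \<alpha> i \<notin> A" using assms(3) by blast+
qed

lemma inj_of_irrefl:
  fixes \<alpha> :: "nat \<Rightarrow> nat"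
  assumes "\<And>i j. i < j \<Longrightarrow> \<alpha> i \<noteq> \<alpha> j"
  shows "inj \<alpha>"
  by (rule injI) (metis assms linorder_neqE_nat)

lemma inj_unbounded:
  fixes \<alpha> :: "nat \<Rightarrow> nat"
  assumes "inj \<alpha>"
  shows "\<exists>j>i. n \<le> \<alpha> j"
proof (rule ccontr)
  assume "\<not> ?thesis"
  then have "\<alpha> ` {i<..} \<subseteq> {..<n}" by (auto simp: not_le)
  then have "finite (\<alpha> ` {i<..})" using finite_subset by blast
  then have "finite {i<..}" using assms by (meson finite_imageD inj_on_subset subset_UNIV)
  then show False by (simp add: infinite_Ioi)
qed

text \<open>An ascending sequence lies inside the cut \<open>A\<close>, a descending one outside.\<close>

lemma no_monotone_sequence:
  assumes lin: "linear lt" and cut: "\<And>x. \<exists>n. \<forall>y\<ge>n. lt x y \<longleftrightarrow> x \<in> A"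
    and good: "good A (trunc k Y)"
    and \<alpha>: "\<And>i. pr i (\<alpha> i) \<in> Y k" "\<And>i x. pr i x \<in> Y k \<Longrightarrow> x = \<alpha> i"
  shows "\<not> (\<forall>i j. i < j \<longrightarrow> lt (\<alpha> i) (\<alpha> j))" "\<not> (\<forall>i j. i < j \<longrightarrow> lt (\<alpha> j) (\<alpha> i))"
proof -
  have irr: "\<not> lt x x" and tr: "lt x y \<Longrightarrow> lt y z \<Longrightarrow> lt x z" for x y z
    using lin unfolding linear_def by blast+
  \<comment> \<open>An injective sequence has later terms past the point from which comparison with
    \<open>\<alpha> i\<close> reveals its side of the cut.\<close>
  have escape: "\<exists>j>i. lt (\<alpha> i) (\<alpha> j) \<longleftrightarrow> \<alpha> i \<in> A" if "inj \<alpha>" for i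
    using cut[of "\<alpha> i"] inj_unbounded[OF that, of i] by blast
  show "\<not> (\<forall>i j. i < j \<longrightarrow> lt (\<alpha> i) (\<alpha> j))"
  proof
    assume asc: "\<forall>i j. i < j \<longrightarrow> lt (\<alpha> i) (\<alpha> j)"
    then have inj: "inj \<alpha>" by (intro inj_of_irrefl) (metis irr)
    then have "\<alpha> i \<in> A" for i using escape[OF inj, of i] asc by blast
    then show False using infinite_range_splits(2)[OF good \<alpha> inj] by blast
  qed
  show "\<not> (\<forall>i j. i < j \<longrightarrow> lt (\<alpha> j) (\<alpha> i))"
  proof
    assume desc: "\<forall>i j. i < j \<longrightarrow> lt (\<alpha> j) (\<alpha> i)"
    then have inj: "inj \<alpha>" by (intro inj_of_irrefl) (metis irr)
    have "\<alpha> i \<notin> A" for i using escape[OF inj, of i] desc irr tr by metis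
    then show False using infinite_range_splits(1)[OF good \<alpha> inj] by blast
  qed
qed

lemma sat_Conjs: "sat M e E (Conjs \<phi>s) \<longleftrightarrow> (\<forall>\<phi>\<in>set \<phi>s. sat M e E \<phi>)"
  by (induction \<phi>s rule: Conjs.induct) auto

lemma sat_LinearOrder: "sat M e E (LinearOrder L R) \<longleftrightarrow>
    (\<forall>n. n \<in> E R \<longrightarrow> (\<exists>x y. n = pr x y \<and> x \<in> E L \<and> y \<in> E L)) \<and>
    (\<forall>x. pr x x \<notin> E R) \<and>
    (\<forall>x y z. pr x y \<in> E R \<and> pr y z \<in> E R \<longrightarrow> pr x z \<in> E R) \<and>
    (\<forall>x y. x \<in> E L \<and> y \<in> E L \<longrightarrow> pr x y \<in> E R \<or> x = y \<or> pr y x \<in> E R)"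
  unfolding LinearOrder_def Let_def by (simp add: sat_Conjs del: Conjs.simps) blast
lemma sat_Stable: "sat M e E (Stable L R) \<longleftrightarrow>
    (\<forall>x\<in>E L. (\<exists>b. \<forall>y\<in>E L. pr y x \<in> E R \<longrightarrow> y < b) \<or> (\<exists>b. \<forall>y\<in>E L. pr x y \<in> E R \<longrightarrow> y < b))"
  by (simp add: Stable_def Let_def) blast

lemma not_valid_SADS:
  assumes lin: "linear lt" and cut: "\<And>x. \<exists>n. \<forall>y\<ge>n. lt x y \<longleftrightarrow> x \<in> A"
    and good: "\<And>n. good A (trunc n Y)"
    and L: "UNIV \<in> range Y" and R: "{pr x y | x y. lt x y} \<in> range Y"
  shows "\<not> valid (range Y) SADS"
proof
  let ?M = "range Y"
  define R where "R = {pr x y | x y. lt x y}"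
  assume valid: "valid ?M SADS"
  define e :: "string \<Rightarrow> nat" where "e = (\<lambda>_. 0)"
  define E where "E = (\<lambda>_::string. Y 0)(''L'' := UNIV, ''R'' := R)"
  have irr: "\<not> lt x x" and tr: "lt x y \<Longrightarrow> lt y z \<Longrightarrow> lt x z" and tot: "lt x y \<or> x = y \<or> lt y x" for x y z
    using lin unfolding linear_def by blast+
  have R_iff: "pr x y \<in> R \<longleftrightarrow> lt x y" for x y by (simp add: R_def)
  have EL: "E ''L'' = UNIV" and ER: "E ''R'' = R" by (simp_all add: E_def)
  have "sat ?M e E (Infinite ''L'')" by (simp add: sat_Infinite EL)
  moreover have "sat ?M e E (LinearOrder ''L'' ''R'')"
  proof -
    have "\<forall>n. n \<in> R \<longrightarrow> (\<exists>x y. n = pr x y)" by (auto simp: R_def)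
    then show ?thesis unfolding sat_LinearOrder EL ER R_iff using irr tr tot by blast
  qed
  moreover have "sat ?M e E (Stable ''L'' ''R'')"
  proof -
    have "(\<exists>b. \<forall>y. lt y x \<longrightarrow> y < b) \<or> (\<exists>b. \<forall>y. lt x y \<longrightarrow> y < b)" for x
    proof -
      obtain n where n: "\<forall>y\<ge>n. lt x y \<longleftrightarrow> x \<in> A" using cut by blast
      show ?thesis
      proof (cases "x \<in> A")
        case True
        then have "\<forall>y. lt y x \<longrightarrow> y < n" using n irr[of x] tr[of x _ x] by (metis not_le)
        then show ?thesis by blast
      next
        case False
        then have "\<forall>y. lt x y \<longrightarrow> y < n" using n by (metis not_le)
        then show ?thesis by blast
      qed
    qed
    then show ?thesis unfolding sat_Stable EL ER R_iff by blast
  qed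
  moreover have "sat ?M e E (Imp (Conjs [Infinite ''L'', LinearOrder ''L'' ''R'', Stable ''L'' ''R''])
      (ExS ''A'' (Conj (SequenceIn ''A'' ''L'') (Disj (Ascending ''A'' ''R'') (Descending ''A'' ''R'')))))"
  proof -
    have "sat ?M e (\<lambda>_. Y 0) SADS" using valid by (auto simp: valid_def)
    from bspec[OF bspec[OF this[unfolded SADS_def sat.simps(7)] L] R[folded R_def]]
    show ?thesis unfolding E_def .
  qed
  ultimately have "sat ?M e E (ExS ''A'' (Conj (SequenceIn ''A'' ''L'')
      (Disj (Ascending ''A'' ''R'') (Descending ''A'' ''R''))))"
    by (simp only: sat.simps Conjs.simps simp_thms)
  then have "\<exists>S\<in>?M. sat ?M e (E(''A'' := S)) (SequenceIn ''A'' ''L'') \<and>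
      (sat ?M e (E(''A'' := S)) (Ascending ''A'' ''R'') \<or> sat ?M e (E(''A'' := S)) (Descending ''A'' ''R''))"
    by (simp only: sat.simps) blast
  then obtain k where seq: "sat ?M e (E(''A'' := Y k)) (SequenceIn ''A'' ''L'')"
    and mono: "sat ?M e (E(''A'' := Y k)) (Ascending ''A'' ''R'') \<or>
      sat ?M e (E(''A'' := Y k)) (Descending ''A'' ''R'')"
    by blast
  have "sat ?M e (E(''A'' := Y k)) (Fun1 ''A'')"
    using seq by (simp add: SequenceIn_def Let_def)
  then have "\<forall>i. \<exists>x. pr i x \<in> Y k \<and> (\<forall>z. pr i z \<in> Y k \<longrightarrow> z = x)"
    by (simp add: sat_Fun1)
  then obtain \<alpha> where \<alpha>: "\<And>i. pr i (\<alpha> i) \<in> Y k" "\<And>i x. pr i x \<in> Y k \<Longrightarrow> x = \<alpha> i"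
    by metis
  have "(\<forall>i j u v. i < j \<and> pr i u \<in> Y k \<and> pr j v \<in> Y k \<longrightarrow> lt u v) \<or>
      (\<forall>i j u v. i < j \<and> pr i u \<in> Y k \<and> pr j v \<in> Y k \<longrightarrow> lt v u)"
    using mono
    by (simp add: Ascending_def Descending_def Let_def Ap1_def ER R_iff)
  then show False
    using no_monotone_sequence[OF lin cut good \<alpha>] \<alpha>(1) by metis
qed

lemma not_valid_CNS:
  assumes cut: "\<And>x. \<exists>n. \<forall>y\<ge>n. lt x y \<longleftrightarrow> x \<in> A"
    and good: "\<And>n. good A (trunc n Y)"
    and F: "{pr (pr x s) (if lt x s then 1 else 0) | x s. True} \<in> range Y"
    and B: "{pr x 1 | x. True} \<in> range Y"
  shows "\<not> valid (range Y) CNS"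
proof
  let ?M = "range Y"
  define F' where "F' = {pr (pr x s) (if lt x s then 1 else 0) | x s. True}"
  define B' :: "nat set" where "B' = {pr x 1 | x. True}"
  assume valid: "valid ?M CNS"
  define e :: "string \<Rightarrow> nat" where "e = (\<lambda>_. 0)"
  define E where "E = (\<lambda>_::string. Y 0)(''F'' := F', ''B'' := B')"
  have F_iff: "pr (pr x s) u \<in> F' \<longleftrightarrow> u = (if lt x s then 1 else 0)" for x s u
    by (auto simp: F'_def)
  have B_iff: "pr x u \<in> B' \<longleftrightarrow> u = 1" for x u by (auto simp: B'_def)
  have EF: "E ''F'' = F'" and EB: "E ''B'' = B'" by (simp_all add: E_def)
  have lim: "(\<exists>s. \<forall>t\<ge>s. pr (pr x t) u \<in> F') \<longleftrightarrow> u = (if x \<in> A then 1 else 0)" for x u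
  proof
    obtain n where n: "\<forall>y\<ge>n. lt x y \<longleftrightarrow> x \<in> A" using cut by blast
    {
      assume "\<exists>s. \<forall>t\<ge>s. pr (pr x t) u \<in> F'"
      then obtain s where "\<forall>t\<ge>s. pr (pr x t) u \<in> F'" ..
      then have "pr (pr x (max s n)) u \<in> F'" by (meson max.cobounded1)
      then have "u = (if lt x (max s n) then 1 else 0)" unfolding F_iff .
      then show "u = (if x \<in> A then 1 else 0)" using n by simp
    }
    assume "u = (if x \<in> A then 1 else 0)"
    then have "\<forall>t\<ge>n. pr (pr x t) u \<in> F'" unfolding F_iff using n by simp
    then show "\<exists>s. \<forall>t\<ge>s. pr (pr x t) u \<in> F'" ..
  qed
  have "sat ?M e E (Fun2 ''F'')"
    unfolding sat_Fun2 EF is_fun2_def F_iff by (auto simp: F'_def)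
  moreover have "sat ?M e E (Fun1 ''B'')"
    unfolding sat_Fun1 EB B_iff by (auto simp: B'_def)
  moreover have "sat ?M e E (AllN ''x'' (ExN ''y'' (Defs.Lim ''F'' (Var ''x'') (Var ''y''))))"
    by (simp add: sat_Lim EF lim)
  moreover have "sat ?M e E (AllNs [''x'', ''y'', ''z''] (Imp (Conj (Defs.Lim ''F'' (Var ''x'') (Var ''y''))
      (Ap1 ''B'' (Var ''x'') (Var ''z''))) (Leq (Var ''y'') (Var ''z''))))"
    by (simp add: sat_Lim EF EB lim B_iff Ap1_def)
  moreover have "sat ?M e E (Imp (Conjs [Fun2 ''F'', Fun1 ''B'',
        AllN ''x'' (ExN ''y'' (Defs.Lim ''F'' (Var ''x'') (Var ''y''))),
        AllNs [''x'', ''y'', ''z''] (Imp (Conj (Defs.Lim ''F'' (Var ''x'') (Var ''y''))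
          (Ap1 ''B'' (Var ''x'') (Var ''z''))) (Leq (Var ''y'') (Var ''z'')))])
      (ExS ''X'' (Conj (Infinite ''X'') (LimNonDecreasingOn ''F'' ''X''))))"
  proof -
    have "sat ?M e (\<lambda>_. Y 0) CNS" using valid by (auto simp: valid_def)
    from bspec[OF bspec[OF this[unfolded CNS_def Let_def sat.simps(7)] F[folded F'_def]] B[folded B'_def]]
    show ?thesis unfolding E_def .
  qed
  ultimately have "\<exists>S\<in>?M. sat ?M e (E(''X'' := S)) (Infinite ''X'') \<and>
      sat ?M e (E(''X'' := S)) (LimNonDecreasingOn ''F'' ''X'')"
    by (simp only: sat.simps Conjs.simps) blast
  then obtain k where inf: "infinite (Y k)" and nd: "nondecreasing_on F' (Y k)"
    unfolding sat_Infinite sat_LimNonDecreasingOn by (auto simp: E_def)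
  obtain x where x: "x \<in> Y k" "x \<in> A" using infinite_column_splits(1)[OF good inf] by blast
  obtain y where y: "x < y" "y \<in> Y k" "y \<notin> A"
    using infinite_column_splits(2)[OF good inf, of "Suc x"] Suc_le_lessD by blast
  show False
    using nd x y unfolding nondecreasing_on_def lim by fastforce
qed

theorem mainTheorem4:
  "\<not> (RCA0 \<union> {LNS} \<turnstile> SADS) \<and> \<not> (RCA0 \<union> {LNS} \<turnstile> CNS)"
proof -
  obtain lt A where lin: "linear lt" and "\<forall>x. \<exists>n. \<forall>y\<ge>n. lt x y \<longleftrightarrow> x \<in> A"
    and good0: "good A (order_env lt)"
    using generic_order by metis
  then have cut: "\<And>x. \<exists>n. \<forall>y\<ge>n. lt x y \<longleftrightarrow> x \<in> A" by blast
  have "\<forall>i>0. order_env lt i = {}" by (simp add: order_env_def)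
  from closed_model[OF good0 this] obtain Y where Y0: "Y 0 = order_env lt 0"
    and good: "\<And>n. good A (trunc n Y)"
    and closed: "\<And>p N. \<exists>n\<ge>N. cont_at (act (Put (Suc n) p)) (trunc n Y) \<longrightarrow> Y (Suc n) = val p (trunc n Y)"
    and lns: "\<And>j. lns_instance (Y j) \<Longrightarrow> \<exists>S\<in>range Y. infinite S \<and> mono_on S (limit (Y j))"
    by metis
  let ?M = "range Y"
  have column: "\<exists>n. Y (Suc n) = val p (trunc n Y)" if "\<And>n. cont_at (act (Put (Suc n) p)) (trunc n Y)" for p
    using closed[of 0 p] that by blast
  have R: "Y 0 = {pr x y | x y. lt x y}" by (simp add: Y0 order_env_def)
  obtain a b c where "Y (Suc a) = val Full (trunc a Y)" "Y (Suc b) = val Ones (trunc b Y)"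
    "Y (Suc c) = val Stages (trunc c Y)"
    using column[OF cont_at_Full] column[OF cont_at_Ones] column[OF cont_at_Stages] by blast
  then have cols: "Y (Suc a) = UNIV" "Y (Suc b) = {pr x 1 | x. True}"
    "Y (Suc c) = {pr (pr x s) (if lt x s then 1 else 0) | x s. True}"
    by (simp_all add: trunc_def R)
  have valid: "valid ?M \<gamma>" if "\<gamma> \<in> RCA0 \<union> {LNS}" for \<gamma>
  proof -
    have "valid ?M LNS" using lns by (intro valid_LNS) blast
    then show ?thesis
      using that valid_basic_axioms valid_Sigma01_induction valid_Delta01_comprehension[OF closed]
      unfolding RCA0_def by blast
  qed
  have "\<not> valid ?M SADS"
    using cols(1) R by (intro not_valid_SADS[OF lin cut good]) (metis rangeI)+
  moreover have "\<not> valid ?M CNS"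
    using cols(2,3) by (intro not_valid_CNS[OF cut good]) (metis rangeI)+
  ultimately show ?thesis using soundness[OF _ valid] by blast
qed

end
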